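(* For every integer $n\ge 4$ we have \begin{align*} A_1(2n,4)&=\frac{19}{16}\, \zeta(2n)+\zeta(\overline{2n})-\frac18\,\zeta(2)\zeta(2n-2),\\ A_2(2n,4)&=\frac{57}{32}\, \zeta(2n)+\frac32\, \zeta(\overline{2n})-\frac3{16}\,\zeta(2) \zeta(2n-2), \\ A_3(2n,4)&=\frac{11}{16}\,\zeta(2n)+\frac32\, \zeta(\overline{2n}) -\frac12\,\zeta(2)\zeta(\overline{2n-2}), \\ A_4(2n,4)&=\frac{11}{64}\,\zeta(2n)+\frac38\, \zeta(\overline{2n}) -\frac18\,\zeta(2)\zeta(\overline{2n-2}), \end{align*} and \begin{equation*} A(2n,4)=\frac{35}{4^{n+1}}\, \zeta(2n)-\frac5{4^n}\,\zeta(2)\zeta(2n-2). \end{equation*}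
   Context: For positive integers $s_1,\dots,s_d$ and signs $\varepsilon_1,\dots,\varepsilon_d\in\{1,-1\}$ with $(s_1,\varepsilon_1)\ne(1,1)$, the (alternating) Euler sum is $$\zeta(s_1,\dots,s_d;\varepsilon_1,\dots,\varepsilon_d)=\sum_{n_1>\cdots>n_d\ge 1}\frac{\varepsilon_1^{n_1}\cdots \varepsilon_d^{n_d}}{ n_1^{s_1}\cdots n_d^{s_d}}.$$ For integers $0\le\alpha\le d\le n$, $$A_\alpha(2n,d)=\sum \zeta(2j_1,\dots,2j_d;\varepsilon_1,\dots,\varepsilon_d),$$ where the sum is over all positive integers $j_1,\dots,j_d$ with $j_1+\cdots+j_d=n$ and all $(\varepsilon_1,\dots,\varepsilon_d)\in\{1,-1\}^d$ with exactly $\alpha$ of the $\varepsilon_\ell$ equal to $-1$; and $A(2n,d)=\sum_{\alpha=0}^d A_\alpha(2n,d)$. Also $\zeta(m)$ is the Riemann zeta value and $\zeta(\overline{m})=\sum_{k\ge1}(-1)^k k^{-m}=(2^{1-m}-1)\zeta(m)$ for $m\ge 2$. *)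

theory Defs
  imports "HOL-Analysis.Analysis"
begin

(* Index and sign strings are lists; position i (0-based) of the list is the index i+1 of the
   text.  The conditions of equal length, positive exponents, signs in {1,-1} and
   (s_1,eps_1) distinct from (1,1) are imposed where the functions are used. *)

definition euler_sum_upto :: "nat \<Rightarrow> nat list \<Rightarrow> int list \<Rightarrow> real" where
  "euler_sum_upto N ss es =
     (\<Sum>ns | length ns = length ss \<and> set ns \<subseteq> {1..N} \<and> sorted_wrt (>) ns.
        \<Prod>i<length ss. of_int (es ! i) ^ (ns ! i) / of_nat (ns ! i) ^ (ss ! i))"

(* Limit of the truncations n_1 \<le> N: this is the value of the series also when the first
   exponent is 1 (with sign -1) and the series converges only conditionally. *)
definition euler_sum :: "nat list \<Rightarrow> int list \<Rightarrow> real" where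
  "euler_sum ss es = lim (\<lambda>N. euler_sum_upto N ss es)"

(* The second argument w is the total weight, so A_{alpha}(2n,d) is A_alt alpha (2 * n) d. *)
definition A_alt :: "nat \<Rightarrow> nat \<Rightarrow> nat \<Rightarrow> real" where
  "A_alt \<alpha> w d =
     (\<Sum>(js, es) \<in> {js. length js = d \<and> (\<forall>j\<in>set js. 1 \<le> j) \<and> 2 * sum_list js = w} \<times>
                  {es. length es = d \<and> set es \<subseteq> {1, -1} \<and> count_list es (-1) = \<alpha>}.
        euler_sum (map (\<lambda>j. 2 * j) js) es)"

definition A_total :: "nat \<Rightarrow> nat \<Rightarrow> real" where
  "A_total w d = (\<Sum>\<alpha>=0..d. A_alt \<alpha> w d)"

(* The series are summed from k = 0 with k shifted by one; both are used for m \<ge> 2 only. *)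
definition zeta_val :: "nat \<Rightarrow> real" where
  "zeta_val m = (\<Sum>k. 1 / of_nat (Suc k) ^ m)"

definition zeta_bar :: "nat \<Rightarrow> real" where
  "zeta_bar m = (\<Sum>k. (-1) ^ Suc k / of_nat (Suc k) ^ m)"

end

theory Submission
  imports Defs
begin

text \<open>
  Let the variable \<open>u\<close> mark negative signs.  For fixed indices \<open>n\<^sub>1 > \<dots> > n\<^sub>d\<close> the sum over all sign patterns
  is the product of the weights \<open>w\<^sub>k = 1 + u (-1)\<^sup>k\<close> over the indices (\<open>sum_sign_lists\<close>), and the sum over
  all exponents is a coefficient of the product of the series \<open>q t / (1 - q t)\<close> with \<open>q = 1 / k\<^sup>2\<close>.
  Decomposing that product into partial fractions (\<open>comp_sum_lagrange\<close>) leaves only one of the indices,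
  say \<open>m\<close>, with the exponent \<open>2n\<close>, while each other index \<open>l\<close> contributes the factor
  \<open>m\<^sup>2 / (l\<^sup>2 - m\<^sup>2)\<close>.  In depth 4 the polynomial \<open>\<Sum>\<alpha>. u\<^sup>\<alpha> A\<^sub>\<alpha>\<close> is therefore the sum over \<open>m\<close> of
  \<open>w\<^sub>m / m ^ (2n)\<close> times the third elementary symmetric function of the numbers
  \<open>w\<^sub>l m\<^sup>2 / (l\<^sup>2 - m\<^sup>2)\<close>, \<open>l \<noteq> m\<close> (\<open>sum_index_lists_eq_esym\<close>).

  The inner symmetric function has a closed form.  By Newton's identity it is a polynomial in power sums
  of \<open>m\<^sup>2 / (l\<^sup>2 - m\<^sup>2)\<close>, with and without the sign \<open>(-1)\<^sup>l\<close>, of order at most three.  Expanding in partial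
  fractions \<open>1 / (l - m)\<^sup>r\<close> and \<open>1 / (l + m)\<^sup>r\<close> makes them sums over all integers with the terms at \<open>0\<close>
  and \<open>m\<close>, \<open>-m\<close> removed; up to these terms odd powers cancel and squares give a rational
  multiple of \<open>m\<^sup>2 \<zeta>(2)\<close>
  (\<open>kernel_power_sums_tendsto\<close>).  The result is affine in \<open>m\<^sup>2 \<zeta>(2)\<close>, with coefficients that depend only
  on \<open>u\<close> and the parity of \<open>m\<close> (\<open>esym3_limit_eq\<close>).  Summing over \<open>m\<close> produces \<open>\<zeta>(2n)\<close>, its alternating
  analogue, and \<open>\<zeta>(2)\<close> times the two zeta values of weight \<open>2n - 2\<close>.

  The passage from truncated to infinite sums is an application of Tannery's theorem
  (\<open>truncated_sum_tendsto\<close>); the trivial bound \<open>O(m ^ 6)\<close> for the symmetric function suffices because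
  \<open>n \<ge> 4\<close>.  Comparing coefficients of \<open>u\<close> gives the single evaluations, and \<open>u = 1\<close> gives the total,
  where the relation between the zeta function and its alternating analogue combines the terms.
\<close>

section \<open>Partial fractions for sums over compositions\<close>

text \<open>
  The coefficient of \<open>t\<^sup>n\<close> in the product of the geometric series \<open>q t / (1 - q t)\<close>, \<open>q\<close> in the list.
\<close>
fun comp_sum :: "real list \<Rightarrow> nat \<Rightarrow> real" where
  "comp_sum [] n = (if n = 0 then 1 else 0)"
| "comp_sum (q # qs) n = (\<Sum>j=1..n. q ^ j * comp_sum qs (n - j))"

text \<open>
  Multiplying the series of \<open>q # qs\<close> by \<open>1 - q t\<close> leaves \<open>q t\<close> times the series of \<open>qs\<close>.
\<close>
lemma comp_sum_Suc:
  "comp_sum (q # qs) (Suc n) = q * (comp_sum qs n + comp_sum (q # qs) n)"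
proof -
  have "comp_sum (q # qs) (Suc n) = (\<Sum>j=0..n. q ^ Suc j * comp_sum qs (n - j))"
    using sum.shift_bounds_cl_Suc_ivl[of "\<lambda>j. q ^ j * comp_sum qs (Suc n - j)" 0 n] by simp
  also have "\<dots> = q * comp_sum qs n + (\<Sum>j=Suc 0..n. q ^ Suc j * comp_sum qs (n - j))"
    by (subst sum.atLeast_Suc_atMost) simp_all
  also have "\<dots> = q * (comp_sum qs n + comp_sum (q # qs) n)"
    by (simp add: sum_distrib_left algebra_simps)
  finally show ?thesis .
qed

text \<open>
  Partial fractions for two of the factors:
  \<open>(a - b) a t b t / ((1 - a t)(1 - b t)) = b (a t / (1 - a t)) - a (b t / (1 - b t))\<close>.
  There is no shift in the degree, so the identity holds coefficient by coefficient.
\<close>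
lemma comp_sum_swap:
  "(a - b) * comp_sum (a # b # qs) n = b * comp_sum (a # qs) n - a * comp_sum (b # qs) n"
proof (induction n)
  case (Suc n)
  have "(a - b) * comp_sum (a # b # qs) (Suc n)
      = a * ((a - b) * comp_sum (b # qs) n + (a - b) * comp_sum (a # b # qs) n)"
    by (simp only: comp_sum_Suc algebra_simps)
  also have "\<dots> = b * comp_sum (a # qs) (Suc n) - a * comp_sum (b # qs) (Suc n)"
    unfolding Suc.IH comp_sum_Suc by (simp add: algebra_simps del: comp_sum.simps)
  finally show ?case .
qed simp

lemma comp_sum_single: "n \<ge> 1 \<Longrightarrow> comp_sum [q] n = q ^ n"
proof -
  assume "n \<ge> 1"
  have "comp_sum [q] n = (\<Sum>j=1..n. if j = n then q ^ j else 0)"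
    unfolding comp_sum.simps by (intro sum.cong) auto
  also have "\<dots> = q ^ n" using \<open>n \<ge> 1\<close> by simp
  finally show ?thesis .
qed

text \<open>
  The partial fraction decomposition of the product of all \<open>q t / (1 - q t)\<close>, proved by splitting off
  two factors and applying the decomposition to the two shorter products.  At \<open>n = 0\<close> it
  would fail: the constant coefficient of \<open>q t / (1 - q t)\<close> is 0 and not \<open>q ^ 0\<close>.
\<close>
lemma comp_sum_lagrange:
  assumes "distinct xs" "inj_on q (set xs)" "xs \<noteq> []" "n \<ge> 1"
  shows "comp_sum (map q xs) n
       = (\<Sum>x\<in>set xs. q x ^ n * (\<Prod>y\<in>set xs - {x}. q y / (q x - q y)))"
  using assms(1-3)
proof (induction "length xs" arbitrary: xs rule: less_induct)
  case less
  show ?case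
  proof (cases xs)
    case (Cons a as)
    show ?thesis
    proof (cases as)
      case Nil
      then show ?thesis using Cons assms(4) comp_sum_single by simp
    next
      case (Cons b r)
      note xs = \<open>xs = a # as\<close> \<open>as = b # r\<close>
      define P where "P x = (\<Prod>y\<in>set r - {x}. q y / (q x - q y))" for x
      have ab: "a \<noteq> b" "a \<notin> set r" "b \<notin> set r" using less.prems(1) xs by auto
      have qab: "q a \<noteq> q b" using less.prems(2) xs ab by (auto simp: inj_on_def)
      have qr: "q x \<noteq> q a" "q x \<noteq> q b" if "x \<in> set r" for x
        using less.prems(2) xs ab that by (auto simp: inj_on_def)
      have one: "comp_sum (map q (c # r)) n
          = q c ^ n * P c + (\<Sum>x\<in>set r. q x ^ n * (q c / (q x - q c) * P x))"
        if "c = a \<or> c = b" for c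
      proof -
        have c: "c \<notin> set r" using that ab by auto
        have "comp_sum (map q (c # r)) n
          = (\<Sum>x\<in>set (c # r). q x ^ n * (\<Prod>y\<in>set (c # r) - {x}. q y / (q x - q y)))"
          by (rule less.hyps) (use that less.prems xs in \<open>auto simp: inj_on_def\<close>)
        also have "\<dots> = q c ^ n * P c
            + (\<Sum>x\<in>set r. q x ^ n * (\<Prod>y\<in>set (c # r) - {x}. q y / (q x - q y)))"
          using c by (simp add: P_def)
        also have "(\<Sum>x\<in>set r. q x ^ n * (\<Prod>y\<in>set (c # r) - {x}. q y / (q x - q y)))
            = (\<Sum>x\<in>set r. q x ^ n * (q c / (q x - q c) * P x))"
        proof (intro sum.cong refl)
          fix x assume "x \<in> set r"
          then have "set (c # r) - {x} = insert c (set r - {x})" using c by auto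
          then show "q x ^ n * (\<Prod>y\<in>set (c # r) - {x}. q y / (q x - q y))
              = q x ^ n * (q c / (q x - q c) * P x)"
            using c by (simp add: P_def)
        qed
        finally show ?thesis .
      qed
      have two: "(\<Prod>y\<in>set xs - {x}. q y / (q x - q y))
          = q a / (q x - q a) * (q b / (q x - q b)) * P x" if "x \<in> set r" for x
      proof -
        have "set xs - {x} = insert a (insert b (set r - {x}))" using xs ab that by auto
        then show ?thesis using ab by (simp add: P_def)
      qed
      have "set xs - {a} = insert b (set r - {a})" "set xs - {b} = insert a (set r - {b})"
        using xs ab by auto
      then have two': "(\<Prod>y\<in>set xs - {a}. q y / (q a - q y)) = q b / (q a - q b) * P a"
          "(\<Prod>y\<in>set xs - {b}. q y / (q b - q y)) = q a / (q b - q a) * P b"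
        using ab by (simp_all add: P_def)
      have "(q a - q b) * comp_sum (map q xs) n
          = q b * comp_sum (map q (a # r)) n - q a * comp_sum (map q (b # r)) n"
        unfolding xs list.map by (rule comp_sum_swap)
      also have "\<dots> = q a ^ n * (q b * P a) - q b ^ n * (q a * P b)
          + (\<Sum>x\<in>set r. q x ^ n * (q b * (q a / (q x - q a)) - q a * (q b / (q x - q b))) * P x)"
        by (subst (1 2) one)
           (simp_all add: algebra_simps sum_distrib_left sum_subtractf)
      also have "(\<Sum>x\<in>set r. q x ^ n * (q b * (q a / (q x - q a)) - q a * (q b / (q x - q b))) * P x)
          = (q a - q b) * (\<Sum>x\<in>set r. q x ^ n * (\<Prod>y\<in>set xs - {x}. q y / (q x - q y)))"
        unfolding sum_distrib_left
      proof (intro sum.cong refl)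
        fix x assume x: "x \<in> set r"
        have "q b * (q a / (q x - q a)) - q a * (q b / (q x - q b))
            = (q a - q b) * (q a / (q x - q a) * (q b / (q x - q b)))"
          using qr[OF x] by (simp add: divide_simps) (simp add: algebra_simps)
        then show "q x ^ n * (q b * (q a / (q x - q a)) - q a * (q b / (q x - q b))) * P x
            = (q a - q b) * (q x ^ n * (\<Prod>y\<in>set xs - {x}. q y / (q x - q y)))"
          unfolding two[OF x] by simp
      qed
      also have "q a ^ n * (q b * P a) - q b ^ n * (q a * P b)
          = (q a - q b) * (q a ^ n * (\<Prod>y\<in>set xs - {a}. q y / (q a - q y))
                         + q b ^ n * (\<Prod>y\<in>set xs - {b}. q y / (q b - q y)))"
        unfolding two' using qab by (simp add: divide_simps) (simp add: algebra_simps)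
      finally have "(q a - q b) * comp_sum (map q xs) n = (q a - q b) *
          (\<Sum>x\<in>set xs. q x ^ n * (\<Prod>y\<in>set xs - {x}. q y / (q x - q y)))"
        using ab by (simp add: xs distrib_left add.assoc)
      then show ?thesis using qab by simp
    qed
  qed (use less.prems in simp)
qed

text \<open>
  Halves of the exponents of the Euler sums of weight \<open>2 n\<close> and depth \<open>d\<close>.
\<close>
definition compositions :: "nat \<Rightarrow> nat \<Rightarrow> nat list set" where
  "compositions d n = {js. length js = d \<and> (\<forall>j\<in>set js. 1 \<le> j) \<and> sum_list js = n}"

lemma compositions_0: "compositions 0 n = (if n = 0 then {[]} else {})"
  by (auto simp: compositions_def)

lemma compositions_Suc:
  "compositions (Suc d) n = (\<Union>j\<in>{1..n}. (#) j ` compositions d (n - j))"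
proof (intro equalityI subsetI)
  fix js assume js: "js \<in> compositions (Suc d) n"
  then obtain j js' where "js = j # js'" by (auto simp: compositions_def length_Suc_conv)
  then show "js \<in> (\<Union>j\<in>{1..n}. (#) j ` compositions d (n - j))"
    using js by (intro UN_I[of j]) (auto simp: compositions_def)
qed (auto simp: compositions_def)

lemma finite_compositions: "finite (compositions d n)"
  by (induction d arbitrary: n) (auto simp: compositions_0 compositions_Suc)

lemma sum_compositions:
  "(\<Sum>js\<in>compositions (length qs) n. \<Prod>i<length qs. qs ! i ^ (js ! i)) = comp_sum qs n"
proof (induction qs arbitrary: n)
  case (Cons q qs)
  have "(\<Sum>js\<in>compositions (length (q # qs)) n. \<Prod>i<length (q # qs). (q # qs) ! i ^ (js ! i))
      = (\<Sum>j\<in>{1..n}. \<Sum>js\<in>(#) j ` compositions (length qs) (n - j).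
           \<Prod>i<length (q # qs). (q # qs) ! i ^ (js ! i))"
    unfolding list.size(4) add_Suc_right add_0_right compositions_Suc
    by (rule sum.UNION_disjoint) (auto simp: finite_compositions)
  also have "\<dots> = (\<Sum>j\<in>{1..n}. q ^ j * comp_sum qs (n - j))"
  proof (intro sum.cong refl)
    fix j
    have "(\<Sum>js\<in>(#) j ` compositions (length qs) (n - j).
           \<Prod>i<length (q # qs). (q # qs) ! i ^ (js ! i))
        = (\<Sum>js\<in>compositions (length qs) (n - j).
           \<Prod>i<length (q # qs). (q # qs) ! i ^ ((j # js) ! i))"
      by (subst sum.reindex) auto
    also have "\<dots> = (\<Sum>js\<in>compositions (length qs) (n - j).
           q ^ j * (\<Prod>i<length qs. qs ! i ^ (js ! i)))"
      by (simp add: prod.lessThan_Suc_shift del: prod.lessThan_Suc)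
    also have "\<dots> = q ^ j * comp_sum qs (n - j)"
      by (simp add: Cons.IH flip: sum_distrib_left)
    finally show "(\<Sum>js\<in>(#) j ` compositions (length qs) (n - j).
           \<Prod>i<length (q # qs). (q # qs) ! i ^ (js ! i)) = q ^ j * comp_sum qs (n - j)" .
  qed
  finally show ?case by simp
qed (simp add: compositions_0)

section \<open>Sums over sign patterns\<close>

definition sign_lists :: "nat \<Rightarrow> int list set" where
  "sign_lists d = {es. length es = d \<and> set es \<subseteq> {1, -1}}"

lemma sign_lists_0: "sign_lists 0 = {[]}"
  by (auto simp: sign_lists_def)

lemma sign_lists_Suc:
  "sign_lists (Suc d) = (#) 1 ` sign_lists d \<union> (#) (-1) ` sign_lists d"
  by (auto simp: sign_lists_def length_Suc_conv image_iff)

lemma finite_sign_lists: "finite (sign_lists d)"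
  by (induction d) (auto simp: sign_lists_0 sign_lists_Suc)

text \<open>
  The variable \<open>u\<close> marks the negative signs.  The sum over all sign patterns factorises over the
  positions, and index \<open>m\<close> acquires the weight \<open>1 + u (-1)\<^sup>m\<close>.
\<close>
lemma sum_sign_lists:
  fixes u :: real
  shows "(\<Sum>es\<in>sign_lists (length ns).
            u ^ count_list es (-1) * (\<Prod>i<length ns. of_int (es ! i) ^ (ns ! i)))
       = (\<Prod>i<length ns. 1 + u * (-1) ^ (ns ! i))"
proof (induction ns)
  case (Cons m ns)
  let ?f = "\<lambda>ms es. u ^ count_list es (-1) * (\<Prod>i<length ms. real_of_int (es ! i) ^ (ms ! i))"
  have "(\<Sum>es\<in>sign_lists (length (m # ns)). ?f (m # ns) es)
      = (\<Sum>es\<in>sign_lists (length ns). ?f (m # ns) (1 # es))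
      + (\<Sum>es\<in>sign_lists (length ns). ?f (m # ns) (-1 # es))"
    unfolding list.size(4) add_Suc_right add_0_right sign_lists_Suc
    by (subst sum.union_disjoint) (auto simp: finite_sign_lists sum.reindex)
  also have "\<dots> = (\<Sum>es\<in>sign_lists (length ns). ?f ns es)
      + u * (-1) ^ m * (\<Sum>es\<in>sign_lists (length ns). ?f ns es)"
    by (simp add: prod.lessThan_Suc_shift sum_distrib_left mult_ac del: prod.lessThan_Suc)
  also have "\<dots> = (\<Prod>i<length (m # ns). 1 + u * (-1) ^ ((m # ns) ! i))"
    unfolding Cons.IH by (simp add: prod.lessThan_Suc_shift algebra_simps del: prod.lessThan_Suc)
  finally show ?case .
qed (simp add: sign_lists_0)

section \<open>Truncated Euler sums and their convergence\<close>

definition index_lists :: "nat \<Rightarrow> nat \<Rightarrow> nat list set" where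
  "index_lists N d = {ns. length ns = d \<and> set ns \<subseteq> {1..N} \<and> sorted_wrt (>) ns}"

lemma index_lists_0: "index_lists N 0 = {[]}"
  by (auto simp: index_lists_def)

lemma index_lists_Suc:
  "index_lists N (Suc d) = (\<Union>m\<in>{1..N}. (#) m ` index_lists (m - 1) d)"
proof (intro equalityI subsetI)
  fix ns assume ns: "ns \<in> index_lists N (Suc d)"
  then obtain m ms where "ns = m # ms" by (auto simp: index_lists_def length_Suc_conv)
  then show "ns \<in> (\<Union>m\<in>{1..N}. (#) m ` index_lists (m - 1) d)"
    using ns by (intro UN_I[of m]) (fastforce simp: index_lists_def)+
next
  fix ns assume "ns \<in> (\<Union>m\<in>{1..N}. (#) m ` index_lists (m - 1) d)"
  then show "ns \<in> index_lists N (Suc d)"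
    by (fastforce simp: index_lists_def)
qed

lemma finite_index_lists: "finite (index_lists N d)"
  by (induction d arbitrary: N) (auto simp: index_lists_0 index_lists_Suc)

lemma distinct_index_lists: "ns \<in> index_lists N d \<Longrightarrow> distinct ns"
  using strict_sorted_iff[of "rev ns"] by (simp add: index_lists_def sorted_wrt_rev)

text \<open>
  Decreasing lists are finite sets, so a summation over them may select any one element first and the
  others afterwards.
\<close>
lemma bij_betw_set_index_lists:
  "bij_betw set (index_lists N d) {S. S \<subseteq> {1..N} \<and> card S = d}"
proof (rule bij_betwI[where g = "\<lambda>S. rev (sorted_list_of_set S)"])
  have fin: "finite S" if "S \<subseteq> {1..N}" for S :: "nat set"
    using that finite_subset by blast
  show "set \<in> index_lists N d \<rightarrow> {S. S \<subseteq> {1..N} \<and> card S = d}"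
    using distinct_index_lists[of _ N d] by (auto simp: index_lists_def distinct_card)
  show "(\<lambda>S. rev (sorted_list_of_set S)) \<in> {S. S \<subseteq> {1..N} \<and> card S = d} \<rightarrow> index_lists N d"
    using fin by (auto simp: index_lists_def sorted_wrt_rev strict_sorted_list_of_set)
  show "rev (sorted_list_of_set (set ns)) = ns" if "ns \<in> index_lists N d" for ns
  proof -
    have "sorted_wrt (<) (rev ns)"
      using that by (simp add: index_lists_def sorted_wrt_rev)
    then have "sorted_list_of_set (set (rev ns)) = rev ns"
      by (metis finite_set_strict_sorted List.finite_set sorted_list_of_set.idem_if_sorted_distinct
          strict_sorted_iff)
    then show ?thesis by simp
  qed
  show "set (rev (sorted_list_of_set S)) = S" if "S \<in> {S. S \<subseteq> {1..N} \<and> card S = d}" for S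
    using that fin by auto
qed

lemma euler_sum_upto_Nil: "euler_sum_upto N [] [] = 1"
proof -
  have "{ns. length ns = length [] \<and> set ns \<subseteq> {1..N} \<and> sorted_wrt (>) ns} = {[]::nat list}"
    by auto
  then show ?thesis by (simp add: euler_sum_upto_def)
qed

text \<open>
  Summing over the outermost index first turns a sum of depth \<open>d + 1\<close> into the partial sums of a
  single series, whose terms contain truncated sums of depth \<open>d\<close>.
\<close>
lemma euler_sum_upto_Cons:
  "euler_sum_upto N (s # ss) (e # es)
     = (\<Sum>m=1..N. of_int e ^ m / of_nat m ^ s * euler_sum_upto (m - 1) ss es)"
proof -
  let ?f = "\<lambda>ss es ns. \<Prod>i<length ss. real_of_int (es ! i) ^ (ns ! i) / of_nat (ns ! i) ^ (ss ! i)"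
  have "euler_sum_upto N (s # ss) (e # es)
      = sum (?f (s # ss) (e # es)) (\<Union>m\<in>{1..N}. (#) m ` index_lists (m - 1) (length ss))"
    unfolding index_lists_Suc[symmetric] by (simp add: euler_sum_upto_def index_lists_def)
  also have "\<dots> = (\<Sum>m=1..N. sum (?f (s # ss) (e # es)) ((#) m ` index_lists (m - 1) (length ss)))"
    by (rule sum.UNION_disjoint) (auto simp: finite_index_lists)
  also have "\<dots> = (\<Sum>m=1..N. of_int e ^ m / of_nat m ^ s * euler_sum_upto (m - 1) ss es)"
  proof (intro sum.cong refl)
    fix m
    have "sum (?f (s # ss) (e # es)) ((#) m ` index_lists (m - 1) (length ss))
        = (\<Sum>ns\<in>index_lists (m - 1) (length ss). of_int e ^ m / of_nat m ^ s * ?f ss es ns)"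
      by (subst sum.reindex) (auto simp: prod.lessThan_Suc_shift simp del: prod.lessThan_Suc)
    also have "\<dots> = of_int e ^ m / of_nat m ^ s * euler_sum_upto (m - 1) ss es"
      unfolding sum_distrib_left[symmetric] by (simp add: euler_sum_upto_def index_lists_def)
    finally show "sum (?f (s # ss) (e # es)) ((#) m ` index_lists (m - 1) (length ss))
        = of_int e ^ m / of_nat m ^ s * euler_sum_upto (m - 1) ss es" .
  qed
  finally show ?thesis .
qed

lemma summable_inverse_squares: "summable (\<lambda>k. 1 / (real (Suc k)) ^ 2)"
  using inverse_squares_sums by (auto simp: sums_iff)

lemma sum_atLeast1_Suc: "(\<Sum>m=1..N. f m) = (\<Sum>k<N. f (Suc k))" for f :: "nat \<Rightarrow> real"
  by (metis One_nat_def lessThan_atLeast0 sum.atLeast1_atMost_eq)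

text \<open>
  Boundedness in depth \<open>d\<close> makes the series of depth \<open>d + 1\<close> absolutely convergent, by comparison
  with the sum of inverse squares; convergence gives boundedness again, which closes the induction.
\<close>
lemma euler_sum_upto_bounded_convergent:
  assumes "length es = length ss" "\<forall>s\<in>set ss. 2 \<le> s" "set es \<subseteq> {1, -1}"
  shows "(\<exists>C. \<forall>N. \<bar>euler_sum_upto N ss es\<bar> \<le> C) \<and> convergent (\<lambda>N. euler_sum_upto N ss es)"
  using assms
proof (induction ss arbitrary: es)
  case Nil
  then show ?case by (auto simp: euler_sum_upto_Nil convergent_const)
next
  case (Cons s ss)
  then obtain e es' where es: "es = e # es'" by (cases es) auto
  define a where "a k = of_int e ^ Suc k / real (Suc k) ^ s * euler_sum_upto k ss es'" for k
  have sums: "euler_sum_upto N (s # ss) es = (\<Sum>k<N. a k)" for N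
    unfolding es euler_sum_upto_Cons sum_atLeast1_Suc by (simp add: a_def)
  obtain C where C: "\<bar>euler_sum_upto N ss es'\<bar> \<le> C" for N
    using Cons.IH[of es'] Cons.prems es by auto
  have a: "norm (a k) \<le> C * (1 / real (Suc k) ^ 2)" for k
  proof -
    have e: "\<bar>real_of_int e ^ Suc k\<bar> = 1" using Cons.prems es by (auto simp: power_abs)
    have "real (Suc k) ^ 2 \<le> real (Suc k) ^ s"
      using Cons.prems by (intro power_increasing) auto
    then have "1 / real (Suc k) ^ s \<le> 1 / real (Suc k) ^ 2"
      by (intro divide_left_mono) auto
    moreover have "norm (a k) = 1 / real (Suc k) ^ s * \<bar>euler_sum_upto k ss es'\<bar>"
      unfolding a_def by (simp only: real_norm_def abs_mult abs_divide e) simp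
    ultimately show ?thesis
      using mult_mono[OF _ C[of k], of "1 / real (Suc k) ^ s" "1 / real (Suc k) ^ 2"]
      by (simp add: mult.commute)
  qed
  have summable: "summable a"
    by (rule summable_comparison_test'[OF summable_mult[OF summable_inverse_squares] a])
  then have "convergent (\<lambda>N. euler_sum_upto N (s # ss) es)"
    unfolding sums by (simp add: summable_iff_convergent)
  then show ?case
    using convergent_imp_Bseq[of "\<lambda>N. euler_sum_upto N (s # ss) es"] by (auto simp: Bseq_def)
qed

lemma euler_sum_upto_tendsto:
  assumes "length es = length ss" "\<forall>s\<in>set ss. 2 \<le> s" "set es \<subseteq> {1, -1}"
  shows "(\<lambda>N. euler_sum_upto N ss es) \<longlonglongrightarrow> euler_sum ss es"
  using euler_sum_upto_bounded_convergent[OF assms]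
  by (simp add: euler_sum_def convergent_LIMSEQ_iff)

section \<open>Elementary symmetric functions\<close>

definition esym :: "nat \<Rightarrow> 'a set \<Rightarrow> ('a \<Rightarrow> real) \<Rightarrow> real" where
  "esym d A f = (\<Sum>T | T \<subseteq> A \<and> card T = d. \<Prod>x\<in>T. f x)"

lemma esym_0: "finite A \<Longrightarrow> esym 0 A f = 1"
proof -
  assume "finite A"
  then have "{T. T \<subseteq> A \<and> card T = 0} = {{}}" using finite_subset by fastforce
  then show ?thesis by (simp add: esym_def)
qed

lemma esym_insert:
  assumes "finite A" "a \<notin> A"
  shows "esym (Suc d) (insert a A) f = esym (Suc d) A f + f a * esym d A f"
proof -
  have fin: "finite {T. T \<subseteq> A \<and> card T = k}" for k
    using assms(1) by simp
  have eq: "{T. T \<subseteq> insert a A \<and> card T = Suc d}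
      = {T. T \<subseteq> A \<and> card T = Suc d} \<union> insert a ` {T. T \<subseteq> A \<and> card T = d}" (is "?L = ?R")
  proof (intro equalityI subsetI)
    fix T assume T: "T \<in> ?L"
    then have "finite T" using assms(1) by (auto intro: finite_subset)
    show "T \<in> ?R"
    proof (cases "a \<in> T")
      case True
      then have "T = insert a (T - {a})" "T - {a} \<subseteq> A" "card (T - {a}) = d"
        using T \<open>finite T\<close> by (auto simp: card_Diff_singleton)
      then show ?thesis by blast
    qed (use T in auto)
  next
    fix T assume "T \<in> ?R"
    then show "T \<in> ?L"
    proof
      assume "T \<in> insert a ` {T. T \<subseteq> A \<and> card T = d}"
      then obtain U where U: "T = insert a U" "U \<subseteq> A" "card U = d" by blast
      then have "finite U" "a \<notin> U" using assms by (auto intro: finite_subset)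
      then show ?thesis using U by auto
    qed auto
  qed
  have inj: "inj_on (insert a) {T. T \<subseteq> A \<and> card T = d}"
    using assms(2) by (auto simp: inj_on_def)
  have "esym (Suc d) (insert a A) f
      = esym (Suc d) A f + (\<Sum>T | T \<subseteq> A \<and> card T = d. \<Prod>x\<in>insert a T. f x)"
    unfolding esym_def eq
    by (subst sum.union_disjoint) (use assms fin in \<open>auto simp: sum.reindex[OF inj]\<close>)
  also have "(\<Sum>T | T \<subseteq> A \<and> card T = d. \<Prod>x\<in>insert a T. f x) = f a * esym d A f"
    unfolding esym_def sum_distrib_left
    by (intro sum.cong refl prod.insert) (use assms in \<open>auto intro: finite_subset\<close>)
  finally show ?thesis .
qed

lemma esym_empty: "esym (Suc d) ({} :: 'a set) f = 0"
proof -
  have "card T \<noteq> Suc d" if "T \<subseteq> {}" for T :: "'a set" using that by simp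
  then show ?thesis unfolding esym_def by (intro sum.neutral) blast
qed

lemma esym_1: "finite A \<Longrightarrow> esym (Suc 0) A f = sum f A"
  by (induction A rule: finite_induct) (simp_all add: esym_insert esym_empty esym_0)

lemma esym_2: "finite A \<Longrightarrow> 2 * esym (Suc (Suc 0)) A f = sum f A ^ 2 - (\<Sum>x\<in>A. f x ^ 2)"
  by (induction A rule: finite_induct)
     (simp_all add: esym_insert esym_empty esym_1 algebra_simps power2_eq_square)

text \<open>
  Newton's identity for the third elementary symmetric function.
\<close>
lemma esym_3:
  "finite A \<Longrightarrow> 6 * esym 3 A f
     = sum f A ^ 3 - 3 * sum f A * (\<Sum>x\<in>A. f x ^ 2) + 2 * (\<Sum>x\<in>A. f x ^ 3)"
  unfolding numeral_3_eq_3
proof (induction A rule: finite_induct)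
  case (insert a A)
  have "f a * (6 * esym (Suc (Suc 0)) A f) = f a * (3 * (sum f A ^ 2 - (\<Sum>x\<in>A. f x ^ 2)))"
    unfolding esym_2[OF insert.hyps(1), of f, symmetric] by simp
  then show ?case
    using insert.IH insert.hyps by (simp add: esym_insert algebra_simps power2_eq_square)
qed (simp add: esym_empty)

section \<open>Reduction of the truncated sums to a single outer index\<close>

text \<open>
  For \<open>q k = 1 / k\<^sup>2\<close> this is the factor \<open>q l / (q m - q l)\<close> of the partial fraction decomposition.
\<close>
definition kernel :: "nat \<Rightarrow> nat \<Rightarrow> real" where
  "kernel m l = real m ^ 2 / (real l ^ 2 - real m ^ 2)"

text \<open>
  The partial fraction decomposition singles out one element \<open>m\<close> of each index set, and only \<open>m\<close>
  carries the exponent \<open>n\<close>.  Exchanging the summations collects, for fixed \<open>m\<close>, the products over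
  all ways to complete \<open>m\<close> to an index set: an elementary symmetric function.
\<close>
lemma sum_index_lists_eq_esym:
  fixes w :: "nat \<Rightarrow> real"
  assumes "n \<ge> 1"
  shows "(\<Sum>ns\<in>index_lists N (Suc d).
            (\<Prod>i<length ns. w (ns ! i)) * comp_sum (map (\<lambda>k. 1 / real k ^ 2) ns) n)
       = (\<Sum>m=1..N. w m / real m ^ (2 * n)
            * esym d ({1..N} - {m}) (\<lambda>l. w l * kernel m l))"
proof -
  define F where "F m S = w m / real m ^ (2 * n)
      * (\<Prod>l\<in>S. w l * kernel m l)" for m S
  have "(\<Prod>i<length ns. w (ns ! i)) * comp_sum (map (\<lambda>k. 1 / real k ^ 2) ns) n
      = (\<Sum>m\<in>set ns. F m (set ns - {m}))" if "ns \<in> index_lists N (Suc d)" for ns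
  proof -
    let ?q = "\<lambda>k. 1 / real k ^ 2"
    have dist: "distinct ns" and "ns \<noteq> []" and pos: "\<And>k. k \<in> set ns \<Longrightarrow> k > 0"
      using that distinct_index_lists[OF that] by (auto simp: index_lists_def)
    have inj: "inj_on ?q (set ns)"
      using pos by (auto simp: inj_on_def power2_eq_iff)
    have "(\<Prod>i<length ns. w (ns ! i)) = (\<Prod>k\<in>set ns. w k)"
      by (rule prod.reindex_bij_betw[OF bij_betw_nth[OF dist refl refl]])
    moreover have "comp_sum (map ?q ns) n
        = (\<Sum>m\<in>set ns. ?q m ^ n * (\<Prod>l\<in>set ns - {m}. ?q l / (?q m - ?q l)))"
      by (rule comp_sum_lagrange) fact+
    moreover have "(\<Prod>k\<in>set ns. w k) * (?q m ^ n * (\<Prod>l\<in>set ns - {m}. ?q l / (?q m - ?q l)))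
        = F m (set ns - {m})" if m: "m \<in> set ns" for m
    proof -
      have "?q l / (?q m - ?q l) = real m ^ 2 / (real l ^ 2 - real m ^ 2)"
        if "l \<in> set ns - {m}" for l
      proof -
        have "real l ^ 2 \<noteq> real m ^ 2" "real l > 0" "real m > 0"
          using that m pos by (auto simp: power2_eq_iff)
        then show ?thesis by (simp add: divide_simps)
      qed
      then have "(\<Prod>l\<in>set ns - {m}. ?q l / (?q m - ?q l))
          = (\<Prod>l\<in>set ns - {m}. real m ^ 2 / (real l ^ 2 - real m ^ 2))"
        by (intro prod.cong) auto
      moreover have "(\<Prod>k\<in>set ns. w k) = w m * (\<Prod>l\<in>set ns - {m}. w l)"
        using m by (simp add: prod.remove)
      ultimately show ?thesis
        unfolding F_def kernel_def prod.distrib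
        by (simp only: power_mult power_one_over) simp
    qed
    ultimately show ?thesis by (simp add: sum_distrib_left)
  qed
  then have "(\<Sum>ns\<in>index_lists N (Suc d).
            (\<Prod>i<length ns. w (ns ! i)) * comp_sum (map (\<lambda>k. 1 / real k ^ 2) ns) n)
      = (\<Sum>ns\<in>index_lists N (Suc d). (\<lambda>S. \<Sum>m\<in>S. F m (S - {m})) (set ns))"
    by (intro sum.cong) auto
  also have "\<dots> = (\<Sum>S | S \<subseteq> {1..N} \<and> card S = Suc d. \<Sum>m\<in>S. F m (S - {m}))"
    by (rule sum.reindex_bij_betw[OF bij_betw_set_index_lists])
  also have "\<dots> = (\<Sum>(S, m)\<in>Sigma {S. S \<subseteq> {1..N} \<and> card S = Suc d} (\<lambda>S. S). F m (S - {m}))"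
    by (rule sum.Sigma) (auto intro: finite_subset)
  also have "\<dots> = (\<Sum>(m, T)\<in>Sigma {1..N} (\<lambda>m. {T. T \<subseteq> {1..N} - {m} \<and> card T = d}). F m T)"
  proof (rule sum.reindex_bij_witness[where i = "\<lambda>(m, T). (insert m T, m)"
          and j = "\<lambda>(S, m). (m, S - {m})"], goal_cases)
    case (2 p)
    then obtain S m where p: "p = (S, m)" and S: "S \<subseteq> {1..N}" "card S = Suc d" "m \<in> S"
      by auto
    have "finite S" by (rule finite_subset[OF S(1)]) simp
    with S show ?case unfolding p by (auto simp: card_Diff_singleton)
  next
    case (4 p)
    then obtain m T where p: "p = (m, T)" and T: "T \<subseteq> {1..N} - {m}" "card T = d" "m \<in> {1..N}"
      by auto
    have "finite T" by (rule finite_subset[OF T(1)]) simp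
    moreover have "m \<notin> T" using T by blast
    ultimately show ?case using T unfolding p by auto
  qed auto
  also have "\<dots> = (\<Sum>m=1..N. \<Sum>T | T \<subseteq> {1..N} - {m} \<and> card T = d. F m T)"
    by (rule sum.Sigma[symmetric]) auto
  also have "\<dots> = (\<Sum>m=1..N. w m / real m ^ (2 * n)
            * esym d ({1..N} - {m}) (\<lambda>l. w l * kernel m l))"
    by (simp add: F_def esym_def sum_distrib_left)
  finally show ?thesis .
qed

section \<open>Power sums of the kernel\<close>

definition psum :: "real \<Rightarrow> nat \<Rightarrow> nat \<Rightarrow> real" where
  "psum \<epsilon> r N = (\<Sum>k=1..N. \<epsilon> ^ k / real k ^ r)"

text \<open>
  For \<open>r = 1\<close> and \<open>\<epsilon> = 1\<close> the sums themselves diverge; only windows of fixed length are small.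
\<close>
lemma psum_gap_tendsto_0:
  assumes "\<bar>\<epsilon>\<bar> = 1" "r \<ge> 1"
  shows "(\<lambda>N. psum \<epsilon> r (N + m) - psum \<epsilon> r N) \<longlonglongrightarrow> 0"
proof -
  have "psum \<epsilon> r (N + m) - psum \<epsilon> r N = (\<Sum>k<m. \<epsilon> ^ Suc (N + k) / real (Suc (N + k)) ^ r)" for N
    by (induction m) (simp_all add: psum_def)
  moreover have "(\<lambda>N. \<epsilon> ^ Suc (N + k) / real (Suc (N + k)) ^ r) \<longlonglongrightarrow> 0" for k
  proof (rule Lim_null_comparison)
    show "\<forall>\<^sub>F N in sequentially. norm (\<epsilon> ^ Suc (N + k) / real (Suc (N + k)) ^ r) \<le> inverse (real (Suc N))"
    proof (intro always_eventually allI)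
      fix N
      have "real (Suc N) \<le> real (Suc (N + k)) ^ 1" by simp
      also have "\<dots> \<le> real (Suc (N + k)) ^ r" using assms(2) by (intro power_increasing) auto
      finally have "inverse (real (Suc (N + k)) ^ r) \<le> inverse (real (Suc N))"
        by (intro le_imp_inverse_le) auto
      moreover have "\<bar>\<epsilon> ^ Suc (N + k)\<bar> = 1" using assms(1) by (simp only: power_abs) simp
      ultimately show "norm (\<epsilon> ^ Suc (N + k) / real (Suc (N + k)) ^ r) \<le> inverse (real (Suc N))"
        by (simp only: real_norm_def abs_divide) (simp add: divide_inverse)
    qed
    show "(\<lambda>N. inverse (real (Suc N))) \<longlonglongrightarrow> 0" by (rule LIMSEQ_inverse_real_of_nat)
  qed
  ultimately show ?thesis by (simp add: tendsto_null_sum)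
qed

text \<open>
  The part \<open>l < m\<close> is reflected by \<open>l \<mapsto> m - l\<close>, the part \<open>l > m\<close> is translated.
\<close>
lemma sum_shift_minus:
  assumes "\<epsilon> * \<epsilon> = 1" "1 \<le> m" "m \<le> N"
  shows "(\<Sum>l\<in>{1..N} - {m}. \<epsilon> ^ l / (real l - real m) ^ r)
       = \<epsilon> ^ m * ((-1) ^ r * psum \<epsilon> r (m - 1) + psum \<epsilon> r (N - m))"
proof -
  have "{1..N} - {m} = {1..m - 1} \<union> {m + 1..N}" using assms by auto
  then have "(\<Sum>l\<in>{1..N} - {m}. \<epsilon> ^ l / (real l - real m) ^ r)
      = (\<Sum>l\<in>{1..m - 1}. \<epsilon> ^ l / (real l - real m) ^ r)
      + (\<Sum>l\<in>{m + 1..N}. \<epsilon> ^ l / (real l - real m) ^ r)"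
    using assms by (simp add: sum.union_disjoint)
  also have "(\<Sum>l\<in>{1..m - 1}. \<epsilon> ^ l / (real l - real m) ^ r)
      = (\<Sum>k\<in>{1..m - 1}. \<epsilon> ^ m * ((-1) ^ r * (\<epsilon> ^ k / real k ^ r)))"
  proof (rule sum.reindex_bij_witness[where i = "\<lambda>k. m - k" and j = "\<lambda>l. m - l"])
    fix l assume l: "l \<in> {1..m - 1}"
    then have m: "m = l + (m - l)" by auto
    have "\<epsilon> ^ m * \<epsilon> ^ (m - l) = \<epsilon> ^ l * (\<epsilon> * \<epsilon>) ^ (m - l)"
      by (subst (1) m) (simp only: power_add power_mult_distrib mult_ac)
    then have "\<epsilon> ^ m * \<epsilon> ^ (m - l) = \<epsilon> ^ l" by (simp add: assms(1))
    moreover have "real l - real m = -1 * real (m - l)"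
      using l by (auto simp: of_nat_diff)
    then have "(real l - real m) ^ r = (-1) ^ r * real (m - l) ^ r"
      by (simp only: power_mult_distrib)
    moreover have "(-1) ^ r / c = 1 / ((-1) ^ r * c)" for c :: real
      by (cases "even r") auto
    moreover have "\<epsilon> ^ m * ((-1) ^ r * (\<epsilon> ^ (m - l) / real (m - l) ^ r))
        = (\<epsilon> ^ m * \<epsilon> ^ (m - l)) * ((-1) ^ r / real (m - l) ^ r)" by simp
    ultimately show "\<epsilon> ^ m * ((-1) ^ r * (\<epsilon> ^ (m - l) / real (m - l) ^ r))
        = \<epsilon> ^ l / (real l - real m) ^ r" by simp
  qed auto
  also have "(\<Sum>l\<in>{m + 1..N}. \<epsilon> ^ l / (real l - real m) ^ r)
      = (\<Sum>k\<in>{1..N - m}. \<epsilon> ^ m * (\<epsilon> ^ k / real k ^ r))"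
    by (rule sum.reindex_bij_witness[where i = "\<lambda>k. k + m" and j = "\<lambda>l. l - m"])
       (auto simp: of_nat_diff simp flip: power_add)
  finally show ?thesis
    by (simp add: psum_def sum_distrib_left distrib_left)
qed

lemma sum_shift_plus:
  assumes "\<epsilon> * \<epsilon> = 1" "1 \<le> m" "m \<le> N"
  shows "(\<Sum>l\<in>{1..N} - {m}. \<epsilon> ^ l / (real l + real m) ^ r)
       = \<epsilon> ^ m * (psum \<epsilon> r (N + m) - psum \<epsilon> r m) - \<epsilon> ^ m / (2 * real m) ^ r"
proof -
  have "(\<Sum>l\<in>{1..N}. \<epsilon> ^ l / (real l + real m) ^ r)
      = (\<Sum>k\<in>{m + 1..N + m}. \<epsilon> ^ m * (\<epsilon> ^ k / real k ^ r))"
  proof (rule sum.reindex_bij_witness[where i = "\<lambda>k. k - m" and j = "\<lambda>l. l + m"])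
    fix l assume "l \<in> {1..N}"
    have "\<epsilon> ^ m * \<epsilon> ^ (l + m) = \<epsilon> ^ l * (\<epsilon> * \<epsilon>) ^ m"
      by (simp only: power_add power_mult_distrib mult_ac)
    then show "\<epsilon> ^ m * (\<epsilon> ^ (l + m) / real (l + m) ^ r) = \<epsilon> ^ l / (real l + real m) ^ r"
      by (simp add: assms(1))
  qed auto
  also have "\<dots> = \<epsilon> ^ m * (psum \<epsilon> r (N + m) - psum \<epsilon> r m)"
  proof -
    have "{1..N + m} = {1..m} \<union> {m + 1..N + m}" using assms by auto
    then have "psum \<epsilon> r (N + m) = psum \<epsilon> r m + (\<Sum>k\<in>{m + 1..N + m}. \<epsilon> ^ k / real k ^ r)"
      by (simp add: psum_def sum.union_disjoint)
    then show ?thesis unfolding sum_distrib_left[symmetric] by simp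
  qed
  finally show ?thesis
    using assms by (simp add: sum_diff1 flip: mult_2)
qed

text \<open>
  In effect the sum of \<open>\<epsilon>\<^sup>l / (l - m)\<^sup>r\<close> over all integers \<open>l\<close> up to \<open>N\<close> in absolute value, apart from
  \<open>0\<close>, \<open>m\<close> and \<open>-m\<close>: the subtracted terms are those of \<open>l = 0\<close> and \<open>l = -m\<close>.
\<close>
lemma sum_both_shifts:
  assumes "\<epsilon> * \<epsilon> = 1" "1 \<le> m" "m \<le> N"
  shows "(\<Sum>l\<in>{1..N} - {m}. \<epsilon> ^ l * (1 / (real l - real m) ^ r + (-1) ^ r / (real l + real m) ^ r))
       = \<epsilon> ^ m * (psum \<epsilon> r (N - m) + (-1) ^ r * psum \<epsilon> r (N + m))
         - (-1) ^ r * (1 / real m ^ r + \<epsilon> ^ m / (2 * real m) ^ r)"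
proof -
  have "psum \<epsilon> r m = psum \<epsilon> r (m - 1) + \<epsilon> ^ m / real m ^ r"
    using assms(2) by (cases m) (simp_all add: psum_def)
  moreover have "\<epsilon> ^ m * \<epsilon> ^ m = 1"
    using assms(1) by (metis power_mult_distrib power_one)
  moreover have "(\<Sum>l\<in>{1..N} - {m}. \<epsilon> ^ l * (1 / (real l - real m) ^ r + (-1) ^ r / (real l + real m) ^ r))
      = (\<Sum>l\<in>{1..N} - {m}. \<epsilon> ^ l / (real l - real m) ^ r)
        + (-1) ^ r * (\<Sum>l\<in>{1..N} - {m}. \<epsilon> ^ l / (real l + real m) ^ r)"
    by (simp add: sum_distrib_left distrib_left sum.distrib mult_ac)
  ultimately show ?thesis
    unfolding sum_shift_minus[OF assms] sum_shift_plus[OF assms]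
    by (simp add: distrib_left right_diff_distrib mult_ac)
qed

text \<open>
  For odd \<open>r\<close> the terms of the sum over all integers cancel in pairs, and only the two missing terms
  survive.
\<close>
lemma odd_shifts_tendsto:
  assumes "\<bar>\<epsilon>\<bar> = 1" "1 \<le> m" "odd r"
  shows "(\<lambda>N. \<Sum>l\<in>{1..N} - {m}. \<epsilon> ^ l * (1 / (real l - real m) ^ r - 1 / (real l + real m) ^ r))
           \<longlonglongrightarrow> 1 / real m ^ r + \<epsilon> ^ m / (2 * real m) ^ r"
proof (rule LIMSEQ_offset[where k = m])
  have eps: "\<epsilon> * \<epsilon> = 1" using abs_mult_self_eq[of \<epsilon>] assms(1) by simp
  have "r \<ge> 1" using assms(3) by (cases r) auto
  have "(\<Sum>l\<in>{1..N + m} - {m}. \<epsilon> ^ l * (1 / (real l - real m) ^ r - 1 / (real l + real m) ^ r))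
      = - (\<epsilon> ^ m * (psum \<epsilon> r (N + 2 * m) - psum \<epsilon> r N)) + (1 / real m ^ r + \<epsilon> ^ m / (2 * real m) ^ r)" for N
  proof -
    have "N + m + m = N + 2 * m" by simp
    then show ?thesis
      using sum_both_shifts[OF eps assms(2), of "N + m" r] assms(3)
      by (simp only: le_add2 diff_add_inverse2) (simp add: right_diff_distrib)
  qed
  moreover have "(\<lambda>N. - (\<epsilon> ^ m * (psum \<epsilon> r (N + 2 * m) - psum \<epsilon> r N))
        + (1 / real m ^ r + \<epsilon> ^ m / (2 * real m) ^ r))
      \<longlonglongrightarrow> - (\<epsilon> ^ m * 0) + (1 / real m ^ r + \<epsilon> ^ m / (2 * real m) ^ r)"
    by (intro tendsto_intros psum_gap_tendsto_0 assms \<open>r \<ge> 1\<close>)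
  ultimately show "(\<lambda>N. \<Sum>l\<in>{1..N + m} - {m}.
        \<epsilon> ^ l * (1 / (real l - real m) ^ r - 1 / (real l + real m) ^ r))
      \<longlonglongrightarrow> 1 / real m ^ r + \<epsilon> ^ m / (2 * real m) ^ r"
    by simp
qed

lemma square_shifts_tendsto:
  assumes "\<bar>\<epsilon>\<bar> = 1" "1 \<le> m" "psum \<epsilon> 2 \<longlonglongrightarrow> \<eta>"
  shows "(\<lambda>N. \<Sum>l\<in>{1..N} - {m}. \<epsilon> ^ l * (1 / (real l - real m) ^ 2 + 1 / (real l + real m) ^ 2))
           \<longlonglongrightarrow> 2 * \<epsilon> ^ m * \<eta> - (1 / real m ^ 2 + \<epsilon> ^ m / (2 * real m) ^ 2)"
proof (rule LIMSEQ_offset[where k = m])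
  have eps: "\<epsilon> * \<epsilon> = 1" using abs_mult_self_eq[of \<epsilon>] assms(1) by simp
  have "(\<Sum>l\<in>{1..N + m} - {m}. \<epsilon> ^ l * (1 / (real l - real m) ^ 2 + 1 / (real l + real m) ^ 2))
      = \<epsilon> ^ m * (psum \<epsilon> 2 N + psum \<epsilon> 2 (N + 2 * m)) - (1 / real m ^ 2 + \<epsilon> ^ m / (2 * real m) ^ 2)" for N
  proof -
    have "N + m + m = N + 2 * m" by simp
    then show ?thesis
      using sum_both_shifts[OF eps assms(2), of "N + m" 2] by (simp only: le_add2 diff_add_inverse2) simp
  qed
  moreover have "(\<lambda>N. \<epsilon> ^ m * (psum \<epsilon> 2 N + psum \<epsilon> 2 (N + 2 * m))
        - (1 / real m ^ 2 + \<epsilon> ^ m / (2 * real m) ^ 2))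
      \<longlonglongrightarrow> \<epsilon> ^ m * (\<eta> + \<eta>) - (1 / real m ^ 2 + \<epsilon> ^ m / (2 * real m) ^ 2)"
    by (intro tendsto_intros assms LIMSEQ_ignore_initial_segment)
  ultimately show "(\<lambda>N. \<Sum>l\<in>{1..N + m} - {m}.
        \<epsilon> ^ l * (1 / (real l - real m) ^ 2 + 1 / (real l + real m) ^ 2))
      \<longlonglongrightarrow> 2 * \<epsilon> ^ m * \<eta> - (1 / real m ^ 2 + \<epsilon> ^ m / (2 * real m) ^ 2)"
    by (simp add: mult_ac)
qed

text \<open>
  All three identities are consequences of \<open>a - b = 2 m a b\<close> and \<open>kernel m l = m\<^sup>2 a b\<close>.
\<close>
lemma kernel_partial_fractions:
  assumes "l \<noteq> m" "1 \<le> m"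
  defines "a \<equiv> 1 / (real l - real m)" and "b \<equiv> 1 / (real l + real m)"
  shows "kernel m l = real m / 2 * (a - b)"
    and "kernel m l ^ 2 = real m ^ 2 / 4 * (a ^ 2 + b ^ 2) - 1 / 2 * kernel m l"
    and "kernel m l ^ 3 = real m ^ 3 / 8 * (a ^ 3 - b ^ 3) - 3 / 4 * kernel m l ^ 2"
proof -
  have "real l - real m \<noteq> 0" "real l + real m \<noteq> 0" using assms(1,2) by auto
  then have ab: "a - b = 2 * real m * (a * b)" and k: "kernel m l = real m ^ 2 * (a * b)"
    by (simp_all add: a_def b_def kernel_def divide_simps power2_eq_square square_diff_square_factored)
  show 1: "kernel m l = real m / 2 * (a - b)"
    unfolding k ab by (simp add: power2_eq_square)
  show "kernel m l ^ 2 = real m ^ 2 / 4 * (a ^ 2 + b ^ 2) - 1 / 2 * kernel m l"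
  proof -
    have "kernel m l ^ 2 = (real m / 2 * (a - b)) ^ 2"
      by (simp only: 1)
    also have "\<dots> = real m ^ 2 / 4 * (a ^ 2 + b ^ 2) - 1 / 2 * (real m ^ 2 * (a * b))"
      by (simp add: power2_eq_square field_simps)
    finally show ?thesis by (simp only: k)
  qed
  have "kernel m l ^ 3 = (real m / 2 * (a - b)) ^ 3"
    by (simp only: 1)
  also have "\<dots> = real m ^ 3 / 8 * (a ^ 3 - b ^ 3) - 3 / 8 * real m ^ 3 * (a * b) * (a - b)"
    by (simp add: power3_eq_cube field_simps)
  also have "3 / 8 * real m ^ 3 * (a * b) * (a - b) = 3 / 4 * kernel m l ^ 2"
    unfolding k ab by (simp add: power2_eq_square power3_eq_cube)
  finally show "kernel m l ^ 3 = real m ^ 3 / 8 * (a ^ 3 - b ^ 3) - 3 / 4 * kernel m l ^ 2" .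
qed

text \<open>
  The number \<open>\<eta>\<close> enters only through the squares \<open>a\<^sup>2 + b\<^sup>2\<close>; the odd powers contribute rational numbers.
\<close>
lemma kernel_power_sums_tendsto:
  assumes "\<bar>\<epsilon>\<bar> = 1" "1 \<le> m" "psum \<epsilon> 2 \<longlonglongrightarrow> \<eta>"
  defines "S2 \<equiv> \<epsilon> ^ m * real m ^ 2 * \<eta> / 2 - 1 / 2 - 3 / 16 * \<epsilon> ^ m"
  shows "(\<lambda>N. \<Sum>l\<in>{1..N} - {m}. \<epsilon> ^ l * kernel m l) \<longlonglongrightarrow> 1 / 2 + \<epsilon> ^ m / 4"
    and "(\<lambda>N. \<Sum>l\<in>{1..N} - {m}. \<epsilon> ^ l * kernel m l ^ 2) \<longlonglongrightarrow> S2"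
    and "(\<lambda>N. \<Sum>l\<in>{1..N} - {m}. \<epsilon> ^ l * kernel m l ^ 3)
           \<longlonglongrightarrow> 1 / 8 + \<epsilon> ^ m / 64 - 3 / 4 * S2"
proof -
  let ?a = "\<lambda>l. 1 / (real l - real m)" and ?b = "\<lambda>l. 1 / (real l + real m)"
  note pf = kernel_partial_fractions[OF _ assms(2)]
  have "(\<lambda>N. real m / 2 * (\<Sum>l\<in>{1..N} - {m}. \<epsilon> ^ l * (?a l ^ 1 - ?b l ^ 1)))
      \<longlonglongrightarrow> real m / 2 * (1 / real m ^ 1 + \<epsilon> ^ m / (2 * real m) ^ 1)"
    unfolding power_one_over by (intro tendsto_intros odd_shifts_tendsto assms) auto
  moreover have "(\<Sum>l\<in>{1..N} - {m}. \<epsilon> ^ l * kernel m l)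
      = real m / 2 * (\<Sum>l\<in>{1..N} - {m}. \<epsilon> ^ l * (?a l ^ 1 - ?b l ^ 1))" for N
    unfolding sum_distrib_left by (intro sum.cong) (auto simp: pf(1))
  moreover have "real m / 2 * (1 / real m ^ 1 + \<epsilon> ^ m / (2 * real m) ^ 1) = 1 / 2 + \<epsilon> ^ m / 4"
    using assms(2) by (simp add: distrib_left)
  ultimately show 1: "(\<lambda>N. \<Sum>l\<in>{1..N} - {m}. \<epsilon> ^ l * kernel m l) \<longlonglongrightarrow> 1 / 2 + \<epsilon> ^ m / 4"
    by (simp only:)
  have "(\<lambda>N. real m ^ 2 / 4 * (\<Sum>l\<in>{1..N} - {m}. \<epsilon> ^ l * (?a l ^ 2 + ?b l ^ 2))
          - 1 / 2 * (\<Sum>l\<in>{1..N} - {m}. \<epsilon> ^ l * kernel m l))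
      \<longlonglongrightarrow> real m ^ 2 / 4 * (2 * \<epsilon> ^ m * \<eta> - (1 / real m ^ 2 + \<epsilon> ^ m / (2 * real m) ^ 2))
          - 1 / 2 * (1 / 2 + \<epsilon> ^ m / 4)"
    unfolding power_one_over by (intro tendsto_intros square_shifts_tendsto 1 assms)
  moreover have "(\<Sum>l\<in>{1..N} - {m}. \<epsilon> ^ l * kernel m l ^ 2)
      = real m ^ 2 / 4 * (\<Sum>l\<in>{1..N} - {m}. \<epsilon> ^ l * (?a l ^ 2 + ?b l ^ 2))
          - 1 / 2 * (\<Sum>l\<in>{1..N} - {m}. \<epsilon> ^ l * kernel m l)" for N
    unfolding sum_distrib_left sum_subtractf[symmetric]
    by (intro sum.cong refl, subst pf(2)) (auto simp: algebra_simps)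
  moreover have "real m ^ 2 / 4 * (2 * \<epsilon> ^ m * \<eta> - (1 / real m ^ 2 + \<epsilon> ^ m / (2 * real m) ^ 2))
          - 1 / 2 * (1 / 2 + \<epsilon> ^ m / 4) = S2"
    using assms(2) unfolding S2_def by (simp add: field_simps)
  ultimately show 2: "(\<lambda>N. \<Sum>l\<in>{1..N} - {m}. \<epsilon> ^ l * kernel m l ^ 2) \<longlonglongrightarrow> S2"
    by (simp only:)
  have "(\<lambda>N. real m ^ 3 / 8 * (\<Sum>l\<in>{1..N} - {m}. \<epsilon> ^ l * (?a l ^ 3 - ?b l ^ 3))
          - 3 / 4 * (\<Sum>l\<in>{1..N} - {m}. \<epsilon> ^ l * kernel m l ^ 2))
      \<longlonglongrightarrow> real m ^ 3 / 8 * (1 / real m ^ 3 + \<epsilon> ^ m / (2 * real m) ^ 3) - 3 / 4 * S2"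
    unfolding power_one_over by (intro tendsto_intros odd_shifts_tendsto 2 assms) auto
  moreover have "(\<Sum>l\<in>{1..N} - {m}. \<epsilon> ^ l * kernel m l ^ 3)
      = real m ^ 3 / 8 * (\<Sum>l\<in>{1..N} - {m}. \<epsilon> ^ l * (?a l ^ 3 - ?b l ^ 3))
          - 3 / 4 * (\<Sum>l\<in>{1..N} - {m}. \<epsilon> ^ l * kernel m l ^ 2)" for N
    unfolding sum_distrib_left sum_subtractf[symmetric]
    by (intro sum.cong refl, subst pf(3)) (auto simp: algebra_simps)
  moreover have "real m ^ 3 / 8 * (1 / real m ^ 3 + \<epsilon> ^ m / (2 * real m) ^ 3)
      = 1 / 8 + \<epsilon> ^ m / 64"
    using assms(2) by (simp add: field_simps)
  ultimately show "(\<lambda>N. \<Sum>l\<in>{1..N} - {m}. \<epsilon> ^ l * kernel m l ^ 3)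
           \<longlonglongrightarrow> 1 / 8 + \<epsilon> ^ m / 64 - 3 / 4 * S2"
    by (simp only:)
qed

section \<open>The two zeta functions\<close>

lemma zeta_sums: "2 \<le> m \<Longrightarrow> (\<lambda>k. 1 / real (Suc k) ^ m) sums zeta_val m"
proof -
  assume "2 \<le> m"
  have "summable (\<lambda>k. 1 / real (Suc k) ^ m)"
  proof (rule summable_comparison_test'[OF summable_inverse_squares])
    fix k
    have "real (Suc k) ^ 2 \<le> real (Suc k) ^ m" using \<open>2 \<le> m\<close> by (intro power_increasing) auto
    then show "norm (1 / real (Suc k) ^ m) \<le> 1 / real (Suc k) ^ 2"
      by (simp add: divide_simps)
  qed
  then show ?thesis by (simp add: zeta_val_def summable_sums)
qed

lemma zeta_bar_sums: "2 \<le> m \<Longrightarrow> (\<lambda>k. (-1) ^ Suc k / real (Suc k) ^ m) sums zeta_bar m"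
proof -
  assume "2 \<le> m"
  have "summable (\<lambda>k. (-1) ^ Suc k / real (Suc k) ^ m)"
  proof (rule summable_comparison_test')
    show "summable (\<lambda>k. 1 / real (Suc k) ^ m)" using zeta_sums[OF \<open>2 \<le> m\<close>] by (simp add: sums_iff)
    show "norm ((-1) ^ Suc k / real (Suc k) ^ m) \<le> 1 / real (Suc k) ^ m" for k
      by (simp add: power_abs)
  qed
  then show ?thesis by (simp add: zeta_bar_def summable_sums)
qed

text \<open>
  In \<open>zeta_val m + zeta_bar m\<close> the odd terms cancel and the even terms are doubled.
\<close>
lemma zeta_bar_eq: "2 \<le> m \<Longrightarrow> zeta_bar m = (2 / 2 ^ m - 1) * zeta_val m"
proof -
  assume m: "2 \<le> m"
  define f :: "nat \<Rightarrow> real" where "f k = 1 / real (Suc k) ^ m + (-1) ^ Suc k / real (Suc k) ^ m" for k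
  have "(f \<circ> (\<lambda>j. 2 * j + 1)) j = 2 / 2 ^ m * (1 / real (Suc j) ^ m)" for j
  proof -
    have "real (Suc (2 * j + 1)) = 2 * real (Suc j)" by simp
    then show ?thesis unfolding f_def o_def by (simp only: power_mult_distrib) simp
  qed
  then have "(f \<circ> (\<lambda>j. 2 * j + 1)) sums (2 / 2 ^ m * zeta_val m)"
    using sums_mult[OF zeta_sums[OF m], of "2 / 2 ^ m"] by presburger
  moreover have "f k = 0" if "k \<notin> range (\<lambda>j. 2 * j + 1)" for k
  proof -
    have "even k" using that by (metis oddE rangeI)
    then show ?thesis by (simp add: f_def)
  qed
  moreover have "strict_mono (\<lambda>j::nat. 2 * j + 1)" by (simp add: strict_mono_def)
  ultimately have "f sums (2 / 2 ^ m * zeta_val m)"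
    using sums_mono_reindex[of "\<lambda>j. 2 * j + 1" f] by (simp add: o_def)
  moreover have "f sums (zeta_val m + zeta_bar m)"
    unfolding f_def by (intro sums_add zeta_sums zeta_bar_sums m)
  ultimately have "zeta_val m + zeta_bar m = 2 / 2 ^ m * zeta_val m"
    using sums_unique2 by blast
  then show ?thesis by (simp add: algebra_simps)
qed

lemma psum_2_tendsto: "psum 1 2 \<longlonglongrightarrow> zeta_val 2" "psum (-1) 2 \<longlonglongrightarrow> - zeta_val 2 / 2"
proof -
  show "psum 1 2 \<longlonglongrightarrow> zeta_val 2"
    using zeta_sums[of 2] unfolding psum_def[abs_def] sum_atLeast1_Suc sums_def by simp
  have "psum (-1) 2 \<longlonglongrightarrow> zeta_bar 2"
    using zeta_bar_sums[of 2] unfolding psum_def[abs_def] sum_atLeast1_Suc sums_def by simp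
  then show "psum (-1) 2 \<longlonglongrightarrow> - zeta_val 2 / 2"
    by (simp add: zeta_bar_eq)
qed

lemma psum_2_le: "psum 1 2 N \<le> zeta_val 2"
  unfolding psum_def sum_atLeast1_Suc zeta_val_def
  using sum_le_suminf[OF summable_inverse_squares, of "{..<N}"] by simp

section \<open>The limit of the inner symmetric function\<close>

lemma esym_mono:
  "(\<And>x. x \<in> A \<Longrightarrow> \<bar>f x\<bar> \<le> g x) \<Longrightarrow> \<bar>esym d A f\<bar> \<le> esym d A g"
  unfolding esym_def
  by (rule order_trans[OF sum_abs], rule sum_mono) (auto simp: abs_prod intro!: prod_mono)

text \<open>
  Every product of \<open>d\<close> distinct values occurs in the expansion of the \<open>d\<close>-th power of the sum.
\<close>
lemma esym_le_power:
  assumes "finite A" "\<And>x. x \<in> A \<Longrightarrow> 0 \<le> f x"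
  shows "0 \<le> esym d A f \<and> esym d A f \<le> sum f A ^ d"
  using assms
proof (induction A arbitrary: d rule: finite_induct)
  case empty
  then show ?case by (cases d) (simp_all add: esym_0 esym_empty)
next
  case (insert a A)
  show ?case
  proof (cases d)
    case (Suc k)
    have f: "0 \<le> f a" "0 \<le> sum f A" using insert.prems by (auto intro: sum_nonneg)
    have IH: "0 \<le> esym j A f" "esym j A f \<le> sum f A ^ j" for j
      using insert.IH[of j] insert.prems by auto
    have "esym (Suc k) A f + f a * esym k A f \<le> sum f A ^ Suc k + f a * sum f A ^ k"
      by (intro add_mono mult_left_mono IH f)
    also have "\<dots> = (f a + sum f A) * sum f A ^ k" by (simp add: algebra_simps)
    also have "\<dots> \<le> (f a + sum f A) * (f a + sum f A) ^ k"
      by (intro mult_left_mono power_mono) (use f in auto)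
    finally show ?thesis using insert.hyps IH f Suc by (simp add: esym_insert)
  qed (use insert.hyps in \<open>simp add: esym_0\<close>)
qed

text \<open>
  Because \<open>\<bar>l\<^sup>2 - m\<^sup>2\<bar> = \<bar>l - m\<bar> (l + m)\<close> and \<open>l + m \<ge> \<bar>l - m\<bar>\<close>.
\<close>
lemma abs_kernel_le:
  assumes "l \<noteq> m"
  shows "\<bar>kernel m l\<bar> \<le> real m ^ 2 * (1 / (real l - real m) ^ 2)"
proof -
  have "(real l - real m) ^ 2 \<le> \<bar>real l ^ 2 - real m ^ 2\<bar>"
  proof -
    have "\<bar>real l - real m\<bar> * \<bar>real l - real m\<bar> \<le> \<bar>real l - real m\<bar> * (real l + real m)"
      by (intro mult_left_mono) auto
    also have "\<dots> = \<bar>real l ^ 2 - real m ^ 2\<bar>"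
      by (simp add: power2_eq_square square_diff_square_factored abs_mult)
    finally show ?thesis by (simp add: power2_eq_square)
  qed
  moreover have "0 < (real l - real m) ^ 2" using assms by simp
  ultimately show ?thesis
    unfolding kernel_def by (simp add: abs_divide) (intro divide_left_mono, auto)
qed

lemma sum_abs_kernel_le:
  assumes "1 \<le> m" "m \<le> N"
  shows "(\<Sum>l\<in>{1..N} - {m}. \<bar>kernel m l\<bar>) \<le> 2 * zeta_val 2 * real m ^ 2"
proof -
  have "(\<Sum>l\<in>{1..N} - {m}. \<bar>kernel m l\<bar>)
      \<le> (\<Sum>l\<in>{1..N} - {m}. real m ^ 2 * (1 ^ l / (real l - real m) ^ 2))"
    unfolding power_one by (intro sum_mono abs_kernel_le) auto
  also have "\<dots> = real m ^ 2 * (psum 1 2 (m - 1) + psum 1 2 (N - m))"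
    unfolding sum_distrib_left[symmetric] using sum_shift_minus[of 1 m N 2] assms by simp
  also have "\<dots> \<le> real m ^ 2 * (zeta_val 2 + zeta_val 2)"
    by (intro mult_left_mono add_mono psum_2_le) auto
  finally show ?thesis by (simp add: mult_ac)
qed

text \<open>
  \<open>S1\<close>, \<open>S2\<close>, \<open>S3\<close> are the limits of the power sums of the kernel at \<open>m\<close>, and \<open>T1\<close>, \<open>T2\<close>, \<open>T3\<close> those of
  the alternating power sums, where \<open>s = (-1)\<^sup>m\<close> and \<open>z = m\<^sup>2 zeta_val 2\<close>.  They are combined to the
  power sums \<open>p1\<close>, \<open>p2\<close>, \<open>p3\<close> of the weighted kernel, to which Newton's identity is applied.
\<close>
definition esym3_limit :: "real \<Rightarrow> real \<Rightarrow> real \<Rightarrow> real" where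
  "esym3_limit u s z =
     (let S1 = 1 / 2 + 1 / 4; T1 = 1 / 2 + s / 4;
          S2 = z / 2 - 1 / 2 - 3 / 16; T2 = - s * z / 4 - 1 / 2 - 3 / 16 * s;
          S3 = 1 / 8 + 1 / 64 - 3 / 4 * S2; T3 = 1 / 8 + s / 64 - 3 / 4 * T2;
          p1 = S1 + u * T1; p2 = (1 + u ^ 2) * S2 + 2 * u * T2;
          p3 = (1 + 3 * u ^ 2) * S3 + (3 * u + u ^ 3) * T3
      in (p1 ^ 3 - 3 * p1 * p2 + 2 * p3) / 6)"

lemma esym3_tendsto:
  fixes u :: real
  assumes "1 \<le> m"
  shows "(\<lambda>N. esym 3 ({1..N} - {m}) (\<lambda>l. (1 + u * (-1) ^ l) * kernel m l))
           \<longlonglongrightarrow> esym3_limit u ((-1) ^ m) (real m ^ 2 * zeta_val 2)"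
proof -
  define A where "A N = {1..N} - {m}" for N
  define S where "S r N = (\<Sum>l\<in>A N. 1 ^ l * kernel m l ^ r)" for r N
  define T where "T r N = (\<Sum>l\<in>A N. (-1) ^ l * kernel m l ^ r)" for r N
  define y where "y l = (1 + u * (-1) ^ l) * kernel m l" for l
  have sq: "(-1) ^ l * (-1) ^ l = (1::real)" for l :: nat
    by (simp flip: power_mult_distrib)
  have p1: "sum y (A N) = S 1 N + u * T 1 N" for N
    unfolding y_def S_def T_def sum_distrib_left sum.distrib[symmetric]
    by (intro sum.cong refl) (simp add: algebra_simps)
  have p2: "(\<Sum>l\<in>A N. y l ^ 2) = (1 + u ^ 2) * S 2 N + 2 * u * T 2 N" for N
    unfolding y_def S_def T_def sum_distrib_left sum.distrib[symmetric]
  proof (intro sum.cong refl)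
    fix l
    have "(1 + u * s) ^ 2 = (1 + u ^ 2) + 2 * u * s" if "s * s = 1" for s :: real
      using that by (simp add: power2_eq_square algebra_simps)
    from this[OF sq[of l]] show "((1 + u * (-1) ^ l) * kernel m l) ^ 2
        = (1 + u ^ 2) * (1 ^ l * kernel m l ^ 2) + 2 * u * ((-1) ^ l * kernel m l ^ 2)"
      unfolding power_mult_distrib by (simp add: algebra_simps)
  qed
  have p3: "(\<Sum>l\<in>A N. y l ^ 3) = (1 + 3 * u ^ 2) * S 3 N + (3 * u + u ^ 3) * T 3 N" for N
    unfolding y_def S_def T_def sum_distrib_left sum.distrib[symmetric]
  proof (intro sum.cong refl)
    fix l
    have e: "(1 + u * (-1) ^ l) ^ 3 = (1 + 3 * u ^ 2) + (3 * u + u ^ 3) * (-1) ^ l"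
      by (cases "even l") (simp_all add: power2_eq_square power3_eq_cube algebra_simps)
    show "((1 + u * (-1) ^ l) * kernel m l) ^ 3
        = (1 + 3 * u ^ 2) * (1 ^ l * kernel m l ^ 3) + (3 * u + u ^ 3) * ((-1) ^ l * kernel m l ^ 3)"
      unfolding power_mult_distrib e by (simp add: algebra_simps)
  qed
  have e: "esym 3 (A N) y = ((S 1 N + u * T 1 N) ^ 3
      - 3 * (S 1 N + u * T 1 N) * ((1 + u ^ 2) * S 2 N + 2 * u * T 2 N)
      + 2 * ((1 + 3 * u ^ 2) * S 3 N + (3 * u + u ^ 3) * T 3 N)) / 6" for N
    using esym_3[of "A N" y] unfolding p1 p2 p3 by (simp add: A_def)
  note S = kernel_power_sums_tendsto[OF _ assms psum_2_tendsto(1), folded A_def]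
  note T = kernel_power_sums_tendsto[OF _ assms psum_2_tendsto(2), folded A_def]
  have s: "S 1 \<longlonglongrightarrow> 1 / 2 + 1 / 4" "S 2 \<longlonglongrightarrow> (real m ^ 2 * zeta_val 2) / 2 - 1 / 2 - 3 / 16"
    "S 3 \<longlonglongrightarrow> 1 / 8 + 1 / 64 - 3 / 4 * ((real m ^ 2 * zeta_val 2) / 2 - 1 / 2 - 3 / 16)"
    using S by (simp_all add: S_def[abs_def])
  have t: "T 1 \<longlonglongrightarrow> 1 / 2 + (-1) ^ m / 4"
    "T 2 \<longlonglongrightarrow> - ((-1) ^ m) * (real m ^ 2 * zeta_val 2) / 4 - 1 / 2 - 3 / 16 * (-1) ^ m"
    "T 3 \<longlonglongrightarrow> 1 / 8 + (-1) ^ m / 64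
       - 3 / 4 * (- ((-1) ^ m) * (real m ^ 2 * zeta_val 2) / 4 - 1 / 2 - 3 / 16 * (-1) ^ m)"
    using T by (simp_all add: T_def[abs_def] mult.assoc)
  show ?thesis
    unfolding esym3_limit_def Let_def A_def[symmetric] y_def[abs_def, symmetric] e
    by (intro tendsto_intros s t) simp
qed

section \<open>Summation over the outer index\<close>

text \<open>
  The coefficient of \<open>u\<^sup>\<alpha>\<close> in these four polynomials is the coefficient of the respective zeta value
  or product of zeta values in the evaluation for \<open>\<alpha>\<close> negative signs.
\<close>
definition coeff_zeta :: "real \<Rightarrow> real" where
  "coeff_zeta u = 35 / 64 + 19 / 16 * u + 57 / 32 * u ^ 2 + 11 / 16 * u ^ 3 + 11 / 64 * u ^ 4"

definition coeff_zeta_bar :: "real \<Rightarrow> real" where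
  "coeff_zeta_bar u = u + 3 / 2 * u ^ 2 + 3 / 2 * u ^ 3 + 3 / 8 * u ^ 4"

definition coeff_zeta2_zeta :: "real \<Rightarrow> real" where
  "coeff_zeta2_zeta u = - 5 / 16 - 1 / 8 * u - 3 / 16 * u ^ 2"

definition coeff_zeta2_zeta_bar :: "real \<Rightarrow> real" where
  "coeff_zeta2_zeta_bar u = - 1 / 2 * u ^ 3 - 1 / 8 * u ^ 4"

text \<open>
  Affine in \<open>z\<close>: the limits \<open>S1\<close>, \<open>T1\<close> do not involve \<open>z\<close>, and \<open>S2\<close>, \<open>T2\<close>, \<open>S3\<close>, \<open>T3\<close> only to
  degree one, while \<open>p2\<close> and \<open>p3\<close> occur linearly and in separate terms of Newton's identity.
  Higher powers of \<open>s\<close> reduce by \<open>s\<^sup>2 = 1\<close>.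
\<close>
lemma esym3_limit_eq:
  assumes "s = 1 \<or> s = -1"
  shows "(1 + u * s) * esym3_limit u s z
       = coeff_zeta u + coeff_zeta_bar u * s
         + (coeff_zeta2_zeta u + coeff_zeta2_zeta_bar u * s) * z"
proof -
  have p4: "x ^ 4 = x * x * x * x" for x :: real by (simp add: power4_eq_xxxx)
  show ?thesis
    using assms unfolding esym3_limit_def Let_def coeff_zeta_def coeff_zeta_bar_def
      coeff_zeta2_zeta_def coeff_zeta2_zeta_bar_def p4 power2_eq_square power3_eq_cube
    by (auto simp: field_simps)
qed

definition depth4_value :: "real \<Rightarrow> nat \<Rightarrow> real" where
  "depth4_value u n = coeff_zeta u * zeta_val (2 * n) + coeff_zeta_bar u * zeta_bar (2 * n)
     + coeff_zeta2_zeta u * zeta_val 2 * zeta_val (2 * n - 2)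
     + coeff_zeta2_zeta_bar u * zeta_val 2 * zeta_bar (2 * n - 2)"

lemma sums_depth4_value:
  assumes "2 \<le> n"
  shows "(\<lambda>k. (1 + u * (-1) ^ Suc k) / real (Suc k) ^ (2 * n)
            * esym3_limit u ((-1) ^ Suc k) (real (Suc k) ^ 2 * zeta_val 2)) sums depth4_value u n"
proof -
  have "(1 + u * (-1) ^ Suc k) / real (Suc k) ^ (2 * n)
            * esym3_limit u ((-1) ^ Suc k) (real (Suc k) ^ 2 * zeta_val 2)
      = coeff_zeta u * (1 / real (Suc k) ^ (2 * n))
        + coeff_zeta_bar u * ((-1) ^ Suc k / real (Suc k) ^ (2 * n))
        + coeff_zeta2_zeta u * zeta_val 2 * (1 / real (Suc k) ^ (2 * n - 2))
        + coeff_zeta2_zeta_bar u * zeta_val 2 * ((-1) ^ Suc k / real (Suc k) ^ (2 * n - 2))" for k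
  proof -
    define s :: real where "s = (-1) ^ Suc k"
    define x where "x = real (Suc k)"
    define X where "X = x ^ (2 * n - 2)"
    have s: "s = 1 \<or> s = -1" unfolding s_def by (rule minus_one_power_iff[THEN ssubst]) simp
    have "x > 0" by (simp add: x_def)
    moreover from this have "X > 0" by (simp add: X_def)
    moreover have "x ^ (2 * n) = x ^ 2 * X"
    proof -
      have "2 * n = 2 + (2 * n - 2)" using assms by simp
      then show ?thesis unfolding X_def by (metis power_add)
    qed
    ultimately show ?thesis
      unfolding s_def[symmetric] x_def[symmetric] X_def[symmetric]
      using esym3_limit_eq[OF s, of u "x ^ 2 * zeta_val 2"]
      by (simp add: field_simps)
  qed
  then show ?thesis
    unfolding depth4_value_def
    by (simp only:) (intro sums_add sums_mult zeta_sums zeta_bar_sums; use assms in linarith)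
qed

text \<open>
  Tannery's theorem.  The symmetric function at \<open>m\<close> is at most the cube of a sum of size \<open>O(m\<^sup>2)\<close>, so
  the terms are \<open>O(m ^ 6 / m ^ (2 * n))\<close> uniformly in \<open>N\<close>.  This is where \<open>n \<ge> 4\<close> enters.
\<close>
lemma truncated_sum_tendsto:
  assumes "4 \<le> n"
  shows "(\<lambda>N. \<Sum>m=1..N. (1 + u * (-1) ^ m) / real m ^ (2 * n)
            * esym 3 ({1..N} - {m}) (\<lambda>l. (1 + u * (-1) ^ l) * kernel m l))
         \<longlonglongrightarrow> depth4_value u n"
proof -
  define g where "g m N = (1 + u * (-1) ^ m) / real m ^ (2 * n)
            * esym 3 ({1..N} - {m}) (\<lambda>l. (1 + u * (-1) ^ l) * kernel m l)" for m N
  \<comment> \<open>Terms beyond the truncation are 0, so that every truncated sum is a series over all \<open>k\<close>.\<close>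
  define a where "a k N = (if k < N then g (Suc k) N else 0)" for k N
  define b where "b k = (1 + u * (-1) ^ Suc k) / real (Suc k) ^ (2 * n)
            * esym3_limit u ((-1) ^ Suc k) (real (Suc k) ^ 2 * zeta_val 2)" for k
  define C where "C = (1 + \<bar>u\<bar>) * ((1 + \<bar>u\<bar>) * (2 * zeta_val 2)) ^ 3"
  have w: "\<bar>1 + u * (-1) ^ l\<bar> \<le> 1 + \<bar>u\<bar>" for l :: nat
    by (cases "even l") auto
  have lim: "a k \<longlonglongrightarrow> b k" for k
  proof -
    have "(\<lambda>N. g (Suc k) N) \<longlonglongrightarrow> b k"
      unfolding g_def b_def by (intro tendsto_intros esym3_tendsto) simp
    moreover have "eventually (\<lambda>N. g (Suc k) N = a k N) sequentially"
      using eventually_gt_at_top[of k] by eventually_elim (simp add: a_def)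
    ultimately show ?thesis by (rule Lim_transform_eventually)
  qed
  have "0 \<le> zeta_val 2"
    using psum_2_le[of 0] by (simp add: psum_def)
  then have "0 \<le> C" by (simp add: C_def)
  have bound: "norm (a k N) \<le> C * (1 / real (Suc k) ^ 2)" for k N
  proof (cases "k < N")
    case True
    define m where "m = Suc k"
    define A where "A = {1..N} - {m}"
    have m: "1 \<le> m" "m \<le> N" using True by (auto simp: m_def)
    have "\<bar>esym 3 A (\<lambda>l. (1 + u * (-1) ^ l) * kernel m l)\<bar>
        \<le> esym 3 A (\<lambda>l. (1 + \<bar>u\<bar>) * \<bar>kernel m l\<bar>)"
      by (rule esym_mono) (simp add: abs_mult mult_right_mono w)
    also have "\<dots> \<le> (\<Sum>l\<in>A. (1 + \<bar>u\<bar>) * \<bar>kernel m l\<bar>) ^ 3"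
      using esym_le_power[of A "\<lambda>l. (1 + \<bar>u\<bar>) * \<bar>kernel m l\<bar>" 3] by (simp add: A_def)
    also have "\<dots> \<le> ((1 + \<bar>u\<bar>) * (2 * zeta_val 2 * real m ^ 2)) ^ 3"
      unfolding sum_distrib_left[symmetric]
      by (intro power_mono mult_left_mono sum_abs_kernel_le[OF m, folded A_def] mult_nonneg_nonneg sum_nonneg)
         auto
    finally have e: "\<bar>esym 3 A (\<lambda>l. (1 + u * (-1) ^ l) * kernel m l)\<bar>
        \<le> ((1 + \<bar>u\<bar>) * (2 * zeta_val 2 * real m ^ 2)) ^ 3" .
    have "norm (a k N) = \<bar>1 + u * (-1) ^ m\<bar> / real m ^ (2 * n)
        * \<bar>esym 3 A (\<lambda>l. (1 + u * (-1) ^ l) * kernel m l)\<bar>"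
      using True by (simp add: a_def g_def m_def A_def abs_mult)
    also have "\<dots> \<le> (1 + \<bar>u\<bar>) / real m ^ (2 * n) * ((1 + \<bar>u\<bar>) * (2 * zeta_val 2 * real m ^ 2)) ^ 3"
      by (intro mult_mono divide_right_mono w e) auto
    also have "\<dots> = C * (real m ^ 6 / real m ^ (2 * n))"
      unfolding C_def power_mult_distrib by (simp flip: power_mult)
    also have "real m ^ 6 / real m ^ (2 * n) = 1 / real m ^ (2 * n - 6)"
    proof -
      have "real m ^ (2 * n) = real m ^ 6 * real m ^ (2 * n - 6)"
        using assms by (simp flip: power_add)
      then show ?thesis using m by simp
    qed
    also have "C * (1 / real m ^ (2 * n - 6)) \<le> C * (1 / real m ^ 2)"
      by (intro mult_left_mono divide_left_mono power_increasing \<open>0 \<le> C\<close>) (use assms m in auto)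
    finally show ?thesis by (simp add: m_def)
  qed (use \<open>0 \<le> C\<close> in \<open>simp add: a_def\<close>)
  have "(\<lambda>N. \<Sum>k. a k N) \<longlonglongrightarrow> suminf b"
    by (rule tannerys_theorem[where M = "\<lambda>k. C * (1 / real (Suc k) ^ 2)",
          THEN conjunct2, THEN conjunct2])
       (use lim bound summable_mult[OF summable_inverse_squares, of C]
         in \<open>auto intro!: always_eventually simp del: of_nat_Suc\<close>)
  moreover have "(\<Sum>k. a k N) = (\<Sum>m=1..N. g m N)" for N
  proof -
    have "(\<Sum>k. a k N) = (\<Sum>k<N. a k N)"
      by (rule suminf_finite) (auto simp: a_def)
    then show ?thesis unfolding sum_atLeast1_Suc by (simp add: a_def)
  qed
  moreover have "suminf b = depth4_value u n"
    using sums_depth4_value[of n u] assms unfolding b_def by (simp add: sums_iff)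
  ultimately show ?thesis by (simp add: g_def)
qed

section \<open>The generating polynomial of the alternating Euler sums\<close>

text \<open>
  For fixed indices the sums over the exponents and over the signs are independent of each other.
\<close>
lemma truncated_generating_sum:
  "(\<Sum>js\<in>compositions d n. \<Sum>es\<in>sign_lists d.
      u ^ count_list es (-1) * euler_sum_upto N (map ((*) 2) js) es)
   = (\<Sum>ns\<in>index_lists N d. (\<Prod>i<length ns. 1 + u * (-1) ^ (ns ! i))
        * comp_sum (map (\<lambda>k. 1 / real k ^ 2) ns) n)"
proof -
  let ?q = "\<lambda>k. 1 / real k ^ 2"
  define P where "P ns es = u ^ count_list es (-1) * (\<Prod>i<length ns. real_of_int (es ! i) ^ (ns ! i))"
    for ns es
  define R where "R ns js = (\<Prod>i<length ns. map ?q ns ! i ^ (js ! i))" for ns js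
  have term_eq: "u ^ count_list es (-1) * euler_sum_upto N (map ((*) 2) js) es
      = (\<Sum>ns\<in>index_lists N d. P ns es * R ns js)" if "js \<in> compositions d n" for js es
  proof -
    have js: "length js = d" using that by (simp add: compositions_def)
    have "euler_sum_upto N (map ((*) 2) js) es
        = (\<Sum>ns\<in>index_lists N d. \<Prod>i<length js.
             real_of_int (es ! i) ^ (ns ! i) / real (ns ! i) ^ (map ((*) 2) js ! i))"
      by (simp add: euler_sum_upto_def index_lists_def js)
    also have "\<dots> = (\<Sum>ns\<in>index_lists N d.
        (\<Prod>i<length ns. real_of_int (es ! i) ^ (ns ! i)) * R ns js)"
      unfolding R_def prod.distrib[symmetric]
      by (intro sum.cong prod.cong refl)
         (auto simp: index_lists_def js power_mult power_one_over)
    finally show ?thesis by (simp add: P_def sum_distrib_left mult.assoc)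
  qed
  have "(\<Sum>js\<in>compositions d n. \<Sum>es\<in>sign_lists d.
      u ^ count_list es (-1) * euler_sum_upto N (map ((*) 2) js) es)
    = (\<Sum>js\<in>compositions d n. \<Sum>es\<in>sign_lists d. \<Sum>ns\<in>index_lists N d. P ns es * R ns js)"
    by (intro sum.cong refl term_eq)
  also have "\<dots> = (\<Sum>js\<in>compositions d n. \<Sum>ns\<in>index_lists N d. \<Sum>es\<in>sign_lists d. P ns es * R ns js)"
    by (intro sum.cong refl sum.swap)
  also have "\<dots> = (\<Sum>ns\<in>index_lists N d. \<Sum>js\<in>compositions d n. \<Sum>es\<in>sign_lists d. P ns es * R ns js)"
    by (rule sum.swap)
  also have "\<dots> = (\<Sum>ns\<in>index_lists N d.
      (\<Sum>es\<in>sign_lists d. P ns es) * (\<Sum>js\<in>compositions d n. R ns js))"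
    by (simp add: sum_distrib_left sum_distrib_right)
  also have "\<dots> = (\<Sum>ns\<in>index_lists N d. (\<Prod>i<length ns. 1 + u * (-1) ^ (ns ! i))
        * comp_sum (map ?q ns) n)"
  proof (intro sum.cong refl)
    fix ns assume "ns \<in> index_lists N d"
    then have len: "length ns = d" by (simp add: index_lists_def)
    have "(\<Sum>es\<in>sign_lists d. P ns es) = (\<Prod>i<length ns. 1 + u * (-1) ^ (ns ! i))"
      using sum_sign_lists[of u ns] by (simp add: P_def len)
    moreover have "(\<Sum>js\<in>compositions d n. R ns js) = comp_sum (map ?q ns) n"
      using sum_compositions[of "map ?q ns" n] by (simp add: R_def len)
    ultimately show "(\<Sum>es\<in>sign_lists d. P ns es) * (\<Sum>js\<in>compositions d n. R ns js)
        = (\<Prod>i<length ns. 1 + u * (-1) ^ (ns ! i)) * comp_sum (map ?q ns) n" by simp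
  qed
  finally show ?thesis .
qed

lemma A_alt_generating_function:
  "(\<Sum>\<alpha>\<in>{0..d}. u ^ \<alpha> * A_alt \<alpha> (2 * n) d)
   = (\<Sum>js\<in>compositions d n. \<Sum>es\<in>sign_lists d.
        u ^ count_list es (-1) * euler_sum (map ((*) 2) js) es)"
proof -
  define h where "h es = (\<Sum>js\<in>compositions d n.
      u ^ count_list es (-1) * euler_sum (map ((*) 2) js) es)" for es
  have "u ^ \<alpha> * A_alt \<alpha> (2 * n) d = (\<Sum>es | es \<in> sign_lists d \<and> count_list es (-1) = \<alpha>. h es)" for \<alpha>
  proof -
    have "{js. length js = d \<and> (\<forall>j\<in>set js. 1 \<le> j) \<and> 2 * sum_list js = 2 * n} = compositions d n"
      by (auto simp: compositions_def)
    moreover have "{es. length es = d \<and> set es \<subseteq> {1, -1} \<and> count_list es (-1) = \<alpha>}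
        = {es \<in> sign_lists d. count_list es (-1) = \<alpha>}"
      by (auto simp: sign_lists_def)
    ultimately have "A_alt \<alpha> (2 * n) d = (\<Sum>js\<in>compositions d n.
        \<Sum>es | es \<in> sign_lists d \<and> count_list es (-1) = \<alpha>. euler_sum (map ((*) 2) js) es)"
      unfolding A_alt_def by (simp only: sum.cartesian_product)
    also have "\<dots> = (\<Sum>es | es \<in> sign_lists d \<and> count_list es (-1) = \<alpha>.
        \<Sum>js\<in>compositions d n. euler_sum (map ((*) 2) js) es)"
      by (rule sum.swap)
    finally show ?thesis by (simp add: h_def sum_distrib_left)
  qed
  then have "(\<Sum>\<alpha>\<in>{0..d}. u ^ \<alpha> * A_alt \<alpha> (2 * n) d)
      = (\<Sum>\<alpha>\<in>{0..d}. \<Sum>es | es \<in> sign_lists d \<and> count_list es (-1) = \<alpha>. h es)" by simp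
  also have "\<dots> = (\<Sum>es\<in>sign_lists d. h es)"
    by (rule sum.group[OF finite_sign_lists]) (auto simp: sign_lists_def count_le_length)
  also have "\<dots> = (\<Sum>js\<in>compositions d n. \<Sum>es\<in>sign_lists d.
        u ^ count_list es (-1) * euler_sum (map ((*) 2) js) es)"
    unfolding h_def by (rule sum.swap)
  finally show ?thesis .
qed

lemma A_alt_depth_4:
  assumes "4 \<le> n"
  shows "(\<Sum>\<alpha>\<in>{0..4}. u ^ \<alpha> * A_alt \<alpha> (2 * n) 4) = depth4_value u n"
proof -
  have "(\<lambda>N. \<Sum>js\<in>compositions 4 n. \<Sum>es\<in>sign_lists 4.
        u ^ count_list es (-1) * euler_sum_upto N (map ((*) 2) js) es)
      \<longlonglongrightarrow> (\<Sum>\<alpha>\<in>{0..4}. u ^ \<alpha> * A_alt \<alpha> (2 * n) 4)"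
    unfolding A_alt_generating_function
    by (intro tendsto_sum tendsto_mult_left euler_sum_upto_tendsto)
       (auto simp: compositions_def sign_lists_def)
  moreover have "(\<Sum>js\<in>compositions 4 n. \<Sum>es\<in>sign_lists 4.
        u ^ count_list es (-1) * euler_sum_upto N (map ((*) 2) js) es)
      = (\<Sum>m=1..N. (1 + u * (-1) ^ m) / real m ^ (2 * n)
            * esym 3 ({1..N} - {m}) (\<lambda>l. (1 + u * (-1) ^ l) * kernel m l))" for N
    unfolding truncated_generating_sum
    using sum_index_lists_eq_esym[of n "\<lambda>k. 1 + u * (-1) ^ k" N 3] assms by simp
  ultimately show ?thesis
    using truncated_sum_tendsto[OF assms, of u] LIMSEQ_unique by simp
qed

theorem proposition7p2:
  fixes n :: nat
  assumes "n \<ge> 4"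
  shows "A_alt 1 (2 * n) 4 =
           19 / 16 * zeta_val (2 * n) + zeta_bar (2 * n)
           - 1 / 8 * zeta_val 2 * zeta_val (2 * n - 2)
       \<and> A_alt 2 (2 * n) 4 =
           57 / 32 * zeta_val (2 * n) + 3 / 2 * zeta_bar (2 * n)
           - 3 / 16 * zeta_val 2 * zeta_val (2 * n - 2)
       \<and> A_alt 3 (2 * n) 4 =
           11 / 16 * zeta_val (2 * n) + 3 / 2 * zeta_bar (2 * n)
           - 1 / 2 * zeta_val 2 * zeta_bar (2 * n - 2)
       \<and> A_alt 4 (2 * n) 4 =
           11 / 64 * zeta_val (2 * n) + 3 / 8 * zeta_bar (2 * n)
           - 1 / 8 * zeta_val 2 * zeta_bar (2 * n - 2)
       \<and> A_total (2 * n) 4 =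
           35 / 4 ^ (n + 1) * zeta_val (2 * n)
           - 5 / 4 ^ n * zeta_val 2 * zeta_val (2 * n - 2)"
proof -
  have gen: "A_alt 0 (2 * n) 4 + u * A_alt 1 (2 * n) 4 + u ^ 2 * A_alt 2 (2 * n) 4
      + u ^ 3 * A_alt 3 (2 * n) 4 + u ^ 4 * A_alt 4 (2 * n) 4 = depth4_value u n" for u
    using A_alt_depth_4[OF assms, of u] by (simp add: numeral_eq_Suc)
  \<comment> \<open>Both sides are polynomials of degree at most 4 in \<open>u\<close>; five values determine the coefficients.\<close>
  note vals = gen[of 0] gen[of 1] gen[of "-1"] gen[of 2] gen[of "-2"]
  define Z B Y V where "Z = zeta_val (2 * n)" and "B = zeta_bar (2 * n)"
    and "Y = zeta_val 2 * zeta_val (2 * n - 2)" and "V = zeta_val 2 * zeta_bar (2 * n - 2)"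
  note defs = depth4_value_def coeff_zeta_def coeff_zeta_bar_def
      coeff_zeta2_zeta_def coeff_zeta2_zeta_bar_def mult.assoc[of _ "zeta_val 2"]
  note vals' = vals[unfolded defs, folded Z_def B_def Y_def V_def, simplified]
  have alt: "A_alt 1 (2 * n) 4 = 19 / 16 * Z + B - 1 / 8 * Y"
    "A_alt 2 (2 * n) 4 = 57 / 32 * Z + 3 / 2 * B - 3 / 16 * Y"
    "A_alt 3 (2 * n) 4 = 11 / 16 * Z + 3 / 2 * B - 1 / 2 * V"
    "A_alt 4 (2 * n) 4 = 11 / 64 * Z + 3 / 8 * B - 1 / 8 * V"
    using vals' unfolding One_nat_def by linarith+
  have pow: "(2::real) ^ (2 * n) = 4 ^ n" "(2::real) ^ (2 * n - 2) = 4 ^ n / 4"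
  proof -
    show 1: "(2::real) ^ (2 * n) = 4 ^ n" by (simp add: power_mult)
    have "(2::real) ^ (2 * n) = 2 ^ (2 * n - 2) * 2 ^ 2"
      unfolding power_add[symmetric] using assms by (intro arg_cong[of _ _ "power 2"]) simp
    then show "(2::real) ^ (2 * n - 2) = 4 ^ n / 4" using 1 by simp
  qed
  have "Z + B = 2 / 4 ^ n * Z"
    using zeta_bar_eq[of "2 * n"] assms by (simp add: B_def Z_def pow left_diff_distrib)
  moreover have "Y + V = 8 / 4 ^ n * Y"
  proof -
    have "zeta_bar (2 * n - 2) = (8 / 4 ^ n - 1) * zeta_val (2 * n - 2)"
      using zeta_bar_eq[of "2 * n - 2"] assms by (simp add: pow)
    then show ?thesis unfolding V_def Y_def by (simp only:) (simp add: algebra_simps)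
  qed
  moreover have "A_total (2 * n) 4 = depth4_value 1 n"
    using A_alt_depth_4[OF assms, of 1] by (simp add: A_total_def)
  moreover have "depth4_value 1 n = 35 / 8 * (Z + B) - 5 / 8 * (Y + V)"
    unfolding defs Z_def B_def Y_def V_def by (simp add: field_simps)
  ultimately have "A_total (2 * n) 4 = 35 / 8 * (2 / 4 ^ n * Z) - 5 / 8 * (8 / 4 ^ n * Y)"
    by (simp only:)
  then have "A_total (2 * n) 4 = 35 / 4 ^ (n + 1) * Z - 5 / 4 ^ n * Y"
    by simp
  then show ?thesis
    using alt by (simp add: Z_def B_def Y_def V_def mult.assoc)
qed

end
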